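(* Let $\phi:X\to X$ be a minimal homeomorphism of a Cantor set and let $\mathcal G:=X\rtimes_\phi\mathbb Z$. Fix $x\in X$, put $A:=\{\phi^n(x)\mid n\ge1\}$, and let \[\mathcal K:=\{g\in\mathcal G\mid r(g)\in A\iff s(g)\in A\}\] be the orbit-breaking subgroupoid. Let $I:\mathsf F(\mathcal G)\to H_1(\mathcal G)\cong\mathbb Z$ be the index map. Then the following hold. (1) The group $\mathsf F(\mathcal K)$ is a maximal subgroup of $\operatorname{Ker}I$. (2) The group $\mathsf D(\mathcal K)$ is a maximal subgroup of $\mathsf D(\mathcal G)$.
   Context: $X\rtimes_\phi\mathbb Z$ is the groupoid $X\times\mathbb Z$ with the product topology, $r(y,n)=y$, $s(y,n)=\phi^{-n}(y)$, $(y,n)(\phi^{-n}(y),m)=(y,n+m)$, and unit space $X$. $\mathcal K$ is an open subgroupoid of $\mathcal G$ with the same unit space $X$. A bisection is a subset on which $r$ and $s$ are injective. For $\mathcal L=\mathcal G$ or $\mathcal K$, a full bisection is a compact open bisection $U\subset\mathcal L$ with $r(U)=s(U)=X$; $\theta_U:=r\circ(s|_U)^{-1}\in\mathrm{Homeo}(X)$. The topological full group $\mathsf F(\mathcal L)$ is the group of all such $\theta_U$ (with $U$ uniquely determined by $\theta_U$), and $\mathsf D(\mathcal L)$ is the commutator subgroup of $\mathsf F(\mathcal L)$. Thus $\mathsf F(\mathcal K)\subset\mathsf F(\mathcal G)$ and $\mathsf D(\mathcal K)\subset\mathsf D(\mathcal G)$; moreover $\mathsf F(\mathcal K)\subset\operatorname{Ker}I$.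 Index map. $H_1(\mathcal G)$ is the first homology of the complex $C_c(\mathcal G^{(n)},\mathbb Z)$ of compactly supported continuous functions on composable $n$-strings ($\mathcal G^{(1)}=\mathcal G$), with $\partial_n=\sum_{i=0}^n(-1)^id_{i*}$, where $d_{i*}$ is summation over fibers of the face maps: $d_0$ drops $g_1$, $d_i$ multiplies $g_ig_{i+1}$, $d_n$ drops $g_n$, and $d_0=s$, $d_1=r$ on $\mathcal G^{(1)}$. The index map is the homomorphism $I(\theta_U):=[1_U]\in H_1(\mathcal G)$. *)

theory Defs
  imports "HOL-Analysis.Analysis" "HOL-Algebra.Coset" "HOL-Algebra.Generated_Groups"
begin

section \<open>Maximal subgroups\<close>

definition maximal_subgroup :: "'a set \<Rightarrow> ('a, 'b) monoid_scheme \<Rightarrow> bool" where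
  "maximal_subgroup M G \<longleftrightarrow>
     group G \<and> subgroup M G \<and> M \<noteq> carrier G \<and>
     (\<forall>H. subgroup H G \<and> M \<subseteq> H \<longrightarrow> H = M \<or> H = carrier G)"


section \<open>Minimal homeomorphisms of Cantor sets\<close>

definition cantor_set :: "'a::topological_space set \<Rightarrow> bool" where
  "cantor_set S \<longleftrightarrow> S homeomorphic (UNIV :: (nat \<Rightarrow> bool) set)"

definition self_homeo :: "('a::topological_space \<Rightarrow> 'a) \<Rightarrow> bool" where
  "self_homeo f \<longleftrightarrow> homeomorphism UNIV UNIV f (inv_into UNIV f)"

definition zpow :: "('a \<Rightarrow> 'a) \<Rightarrow> int \<Rightarrow> 'a \<Rightarrow> 'a" where
  "zpow f n = (if n \<ge> 0 then f ^^ nat n else inv_into UNIV f ^^ nat (- n))"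

definition minimal :: "('a::topological_space \<Rightarrow> 'a) \<Rightarrow> bool" where
  "minimal f \<longleftrightarrow> (\<forall>x. closure (range (\<lambda>n. zpow f n x)) = UNIV)"


section \<open>Groupoids\<close>

text \<open>
  The unit space is identified with the whole type \<open>'x\<close>, and the topology on the arrows is the
  subspace topology inherited from the type \<open>'g\<close>. The product \<open>prd g h\<close> is meaningful only if
  \<open>src g = rng h\<close>.
\<close>

record ('g, 'x) groupoid =
  arrows :: "'g set"
  rng :: "'g \<Rightarrow> 'x"
  src :: "'g \<Rightarrow> 'x"
  prd :: "'g \<Rightarrow> 'g \<Rightarrow> 'g"

definition transformation_groupoid :: "('x \<Rightarrow> 'x) \<Rightarrow> ('x \<times> int, 'x) groupoid" where
  "transformation_groupoid \<phi> =
     \<lparr> arrows = UNIV,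
       rng = (\<lambda>(y, n). y),
       src = (\<lambda>(y, n). zpow \<phi> (- n) y),
       prd = (\<lambda>(y, n) (z, m). (y, n + m)) \<rparr>"

definition forward_orbit :: "('x \<Rightarrow> 'x) \<Rightarrow> 'x \<Rightarrow> 'x set" where
  "forward_orbit \<phi> x = {(\<phi> ^^ n) x | n. n \<ge> 1}"

definition orbit_breaking :: "('x \<Rightarrow> 'x) \<Rightarrow> 'x \<Rightarrow> ('x \<times> int, 'x) groupoid" where
  "orbit_breaking \<phi> x =
     (let G = transformation_groupoid \<phi>; A = forward_orbit \<phi> x
      in G \<lparr> arrows := {g \<in> arrows G. rng G g \<in> A \<longleftrightarrow> src G g \<in> A} \<rparr>)"


section \<open>Topological full groups\<close>

definition full_bisection :: "('g::topological_space, 'x) groupoid \<Rightarrow> 'g set \<Rightarrow> bool" where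
  "full_bisection L U \<longleftrightarrow>
     U \<subseteq> arrows L \<and> compact U \<and> openin (top_of_set (arrows L)) U \<and>
     inj_on (rng L) U \<and> inj_on (src L) U \<and>
     rng L ` U = UNIV \<and> src L ` U = UNIV"

definition theta :: "('g, 'x) groupoid \<Rightarrow> 'g set \<Rightarrow> 'x \<Rightarrow> 'x" where
  "theta L U = rng L \<circ> inv_into U (src L)"

definition full_group :: "('g::topological_space, 'x) groupoid \<Rightarrow> ('x \<Rightarrow> 'x) monoid" where
  "full_group L =
     \<lparr> carrier = {theta L U | U. full_bisection L U}, mult = (\<circ>), one = id \<rparr>"

definition commutator_group :: "('g::topological_space, 'x) groupoid \<Rightarrow> ('x \<Rightarrow> 'x) set" where
  "commutator_group L = derived (full_group L) (carrier (full_group L))"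


section \<open>First groupoid homology\<close>

text \<open>
  Elements of \<open>C\<^sub>c(Y, \<int>)\<close> are represented by their extensions by zero, so that distinct
  representatives are distinct chains.
\<close>

definition Cc :: "'b::topological_space set \<Rightarrow> ('b \<Rightarrow> int) set" where
  "Cc Y = {f. continuous_on Y f \<and> (\<exists>C. compact C \<and> C \<subseteq> Y \<and> (\<forall>z. z \<notin> C \<longrightarrow> f z = 0))}"

text \<open>
  Summation over the fibres of \<open>p\<close>. The support of \<open>f\<close> is part of the index set because
  \<open>sum\<close> is \<open>0\<close> on infinite sets; for local homeomorphisms \<open>p\<close> and \<open>f\<close> in \<open>C\<^sub>c\<close>
  the index set is finite. As \<open>f\<close> vanishes off its domain, only the fibres of \<open>p\<close> within
  that domain contribute.
\<close>

definition pushforward :: "('b \<Rightarrow> 'c) \<Rightarrow> ('b \<Rightarrow> int) \<Rightarrow> 'c \<Rightarrow> int" where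
  "pushforward p f w = (\<Sum>z | p z = w \<and> f z \<noteq> 0. f z)"

definition composable_pairs :: "('g, 'x) groupoid \<Rightarrow> ('g \<times> 'g) set" where
  "composable_pairs L = {(g, h). g \<in> arrows L \<and> h \<in> arrows L \<and> src L g = rng L h}"

text \<open>
  The differentials in degrees 1 and 2 of the complex \<open>C\<^sub>c(L\<^sup>(\<^sup>n\<^sup>), \<int>)\<close>, the only ones that enter
  \<open>H\<^sub>1\<close>; the terms are \<open>d\<^sub>0\<close>, \<open>d\<^sub>1\<close>, \<open>d\<^sub>2\<close> in this order.
\<close>

definition boundary1 :: "('g, 'x) groupoid \<Rightarrow> ('g \<Rightarrow> int) \<Rightarrow> 'x \<Rightarrow> int" where
  "boundary1 L f = (\<lambda>y. pushforward (src L) f y - pushforward (rng L) f y)"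

definition boundary2 :: "('g, 'x) groupoid \<Rightarrow> ('g \<times> 'g \<Rightarrow> int) \<Rightarrow> 'g \<Rightarrow> int" where
  "boundary2 L f = (\<lambda>k.
     pushforward (\<lambda>(g, h). h) f k
     - pushforward (\<lambda>(g, h). prd L g h) f k
     + pushforward (\<lambda>(g, h). g) f k)"

definition cycle_group :: "('g::topological_space, 'x) groupoid \<Rightarrow> ('g \<Rightarrow> int) monoid" where
  "cycle_group L =
     \<lparr> carrier = {f \<in> Cc (arrows L). boundary1 L f = (\<lambda>_. 0)},
       mult = (\<lambda>f g z. f z + g z),
       one = (\<lambda>_. 0) \<rparr>"

definition boundary_group :: "('g::topological_space, 'x) groupoid \<Rightarrow> ('g \<Rightarrow> int) set" where
  "boundary_group L = boundary2 L ` Cc (composable_pairs L)"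

definition H1 :: "('g::topological_space, 'x) groupoid \<Rightarrow> ('g \<Rightarrow> int) set monoid" where
  "H1 L = cycle_group L Mod boundary_group L"

definition homology_class :: "('g::topological_space, 'x) groupoid \<Rightarrow> ('g \<Rightarrow> int) \<Rightarrow> ('g \<Rightarrow> int) set" where
  "homology_class L c = boundary_group L #>\<^bsub>cycle_group L\<^esub> c"


section \<open>The index map\<close>

definition index_map :: "('g::topological_space, 'x) groupoid \<Rightarrow> ('x \<Rightarrow> 'x) \<Rightarrow> ('g \<Rightarrow> int) set" where
  "index_map L \<alpha> =
     homology_class L (indicator (THE U. full_bisection L U \<and> theta L U = \<alpha>))"

definition index_kernel :: "('g::topological_space, 'x) groupoid \<Rightarrow> ('x \<Rightarrow> 'x) set" where
  "index_kernel L = kernel (full_group L) (H1 L) (index_map L)"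

end

theory Submission
  imports Defs "HOL-Algebra.Sym_Groups"
begin

text \<open>
  Let \<open>A\<close> be the forward orbit. Full group elements preserving \<open>A\<close> form the full group of the
  orbit-breaking groupoid, and the index of \<open>\<alpha>\<close> is, up to sign, the difference of the numbers of points that \<open>\<alpha>\<close> moves
  into and out of \<open>A\<close>. Hence both claims say that the stabilizer of \<open>A\<close> is maximal in a group that
  moves \<open>A\<close> to sets obtained by exchanging finitely many points; commutators of local transpositions
  provide enough elements for a double coset argument.

  For the commutator subgroups one needs in addition that an element \<open>\<gamma>\<close> of the large commutator subgroup
  that preserves \<open>A\<close> is a product of commutators of elements preserving \<open>A\<close>. Near \<open>x\<close> the cocycles
  of finitely many full group elements are constant, so a long orbit segment from a neighbourhood of
  \<open>x\<close> to itself can be closed up to a cycle on which these elements act compatibly with composition. Commutators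
  act by even permutations, so \<open>\<gamma>\<close> is an even permutation on every tower over a small clopen
  neighbourhood of \<open>x\<close>, and large alternating groups are perfect.
\<close>

section \<open>Maximality of stabilizers\<close>

text \<open>Applied to \<open>DG\<close>, the stabilizer argument gives maximality of
  \<open>DG \<inter> FK\<close>, which a priori may exceed \<open>DK\<close>: an element of
  \<open>DG\<close> is a product of commutators of maps that may move points across the cut between
  \<open>x\<close> and \<open>P 1 x\<close>. Such maps need not act on the towers over a
  neighbourhood of \<open>x\<close>, so they have no sign there. Closing the towers up to cycles
  gives them one, multiplicative only close to \<open>x\<close>, on a neighbourhood depending on the
  maps; this suffices because an element of \<open>DG\<close> involves finitely many of them. An
  element that preserves \<open>A\<close> does not use the closing edge when both ends are close to
  \<open>x\<close>, so its cyclic permutation is its true action on the tower.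

  On the homology side, every chain is homologous to one on the arrows \<open>(y, 1)\<close>. For a
  bisection this chain is a continuous function invariant under \<phi>, constant by minimality, and
  its value at \<open>P 1 x\<close> counts the crossings of the cut.\<close>

abbreviation fun_group :: "('a \<Rightarrow> 'a) set \<Rightarrow> ('a \<Rightarrow> 'a) monoid" where
  "fun_group \<Gamma> \<equiv> \<lparr>carrier = \<Gamma>, mult = (\<circ>), one = id\<rparr>"

lemma image_o: "(f \<circ> g) ` A = f ` (g ` A)"
  by auto

lemma fun_groupI:
  assumes "id \<in> \<Gamma>" "\<And>f g. f \<in> \<Gamma> \<Longrightarrow> g \<in> \<Gamma> \<Longrightarrow> f \<circ> g \<in> \<Gamma>"
    and "\<And>f. f \<in> \<Gamma> \<Longrightarrow> bij f" "\<And>f. f \<in> \<Gamma> \<Longrightarrow> inv_into UNIV f \<in> \<Gamma>"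
  shows "group (fun_group \<Gamma>)"
proof (rule groupI)
  fix f assume "f \<in> carrier (fun_group \<Gamma>)"
  thus "\<exists>g\<in>carrier (fun_group \<Gamma>). g \<otimes>\<^bsub>fun_group \<Gamma>\<^esub> f = \<one>\<^bsub>fun_group \<Gamma>\<^esub>"
    using assms(3,4) by (intro bexI[of _ "inv_into UNIV f"]) (auto simp: bij_is_inj)
qed (use assms in \<open>auto simp: comp_assoc\<close>)

lemma fun_group_inv:
  assumes "group (fun_group \<Gamma>)" "f \<in> \<Gamma>" "bij f"
  shows "inv\<^bsub>fun_group \<Gamma>\<^esub> f = inv_into UNIV f"
proof -
  interpret group "fun_group \<Gamma>" by fact
  have "(inv\<^bsub>fun_group \<Gamma>\<^esub> f) \<circ> f = id" using l_inv[of f] assms by simp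
  hence "\<And>y. (inv\<^bsub>fun_group \<Gamma>\<^esub> f) (f y) = y" by (metis comp_apply id_apply)
  hence "(inv\<^bsub>fun_group \<Gamma>\<^esub> f) z = inv_into UNIV f z" for z
    using assms(3) by (metis bij_inv_eq_iff)
  thus ?thesis by auto
qed

lemma fun_subgroupI:
  assumes G: "group (fun_group \<Gamma>)" and sub: "\<Delta> \<subseteq> \<Gamma>" and "id \<in> \<Delta>"
    and "\<And>f g. f \<in> \<Delta> \<Longrightarrow> g \<in> \<Delta> \<Longrightarrow> f \<circ> g \<in> \<Delta>"
    and b: "\<And>f. f \<in> \<Delta> \<Longrightarrow> bij f" and "\<And>f. f \<in> \<Delta> \<Longrightarrow> inv_into UNIV f \<in> \<Delta>"
  shows "subgroup \<Delta> (fun_group \<Gamma>)"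
proof (rule group.subgroupI[OF G])
  fix a assume "a \<in> \<Delta>" thus "inv\<^bsub>fun_group \<Gamma>\<^esub> a \<in> \<Delta>"
    using fun_group_inv[OF G, of a] assms by auto
qed (use assms in auto)

lemma card_exchange:
  assumes "finite S" "b \<in> S" "a \<notin> S"
  shows "card (insert a (S - {b})) = card S"
  using assms card_Suc_Diff1[OF assms(1,2)] by simp

lemma bij_involution: "(\<And>z. s (s z) = z) \<Longrightarrow> bij s \<and> inv_into UNIV s = s"
  by (metis (no_types, lifting) bijI' ext inv_unique_comp comp_def id_apply)

text \<open>The points of \<open>S - S'\<close> are moved one at a time. Each move also fixes the
  rest of \<open>S\<close>, so \<open>S\<close> loses one point outside \<open>S'\<close> and gains
  one inside. Fixing \<open>T\<close> is what later allows two such moves, one on each side of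
  \<open>A\<close>, to be composed.\<close>

lemma exists_move_subset:
  fixes Q :: "('a \<Rightarrow> 'a) set"
  assumes id: "id \<in> Q" and comp: "\<And>f g. f \<in> Q \<Longrightarrow> g \<in> Q \<Longrightarrow> f \<circ> g \<in> Q"
    and move: "\<And>p q T. finite T \<Longrightarrow> p \<noteq> q \<Longrightarrow> p \<notin> T \<Longrightarrow> q \<notin> T \<Longrightarrow> p \<in> B \<Longrightarrow> q \<in> B
       \<Longrightarrow> \<exists>k\<in>Q. k p = q \<and> (\<forall>t\<in>T. k t = t)"
    and "finite S" "finite S'" "finite T" "S \<subseteq> B" "S' \<subseteq> B" "card S = card S'"
      "S \<inter> T = {}" "S' \<inter> T = {}"
  shows "\<exists>k\<in>Q. k ` S = S' \<and> (\<forall>t\<in>T. k t = t)"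
  using assms(4-)
proof (induction "card (S - S')" arbitrary: S)
  case 0
  hence "S = S'" by (simp add: card_subset_eq)
  thus ?case using id by (intro bexI[of _ id]) auto
next
  case (Suc n)
  then obtain p where p: "p \<in> S" "p \<notin> S'"
    by (metis Diff_iff card.empty ex_in_conv nat.simps(3))
  have "S' - S \<noteq> {}"
    using p Suc.prems by (metis Diff_eq_empty_iff card_subset_eq)
  then obtain q where q: "q \<in> S'" "q \<notin> S" by auto
  obtain k where k: "k \<in> Q" "k p = q" "\<And>t. t \<in> T \<union> (S - {p}) \<Longrightarrow> k t = t"
    using move[of "T \<union> (S - {p})" p q] p q Suc.prems by (auto simp: subset_iff disjoint_iff)
  have kS: "k ` S = insert q (S - {p})"
  proof -
    have "S = insert p (S - {p})" using p by auto
    hence "k ` S = insert (k p) (k ` (S - {p}))" by (metis image_insert)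
    also have "k ` (S - {p}) = S - {p}" using k(3) by (force simp: image_iff)
    finally show ?thesis using k(2) by simp
  qed
  have "insert q (S - {p}) - S' = (S - S') - {p}" using q p by auto
  hence c: "n = card (insert q (S - {p}) - S')"
    using Suc.hyps(2) p Suc.prems(1) by (simp add: card_Diff_singleton)
  have "card (insert q (S - {p})) = card S'"
    using card_exchange[OF Suc.prems(1) p(1) q(2)] Suc.prems by simp
  moreover have "insert q (S - {p}) \<subseteq> B" using Suc.prems q by auto
  moreover have "insert q (S - {p}) \<inter> T = {}" using Suc.prems q by auto
  ultimately have "\<exists>k'\<in>Q. k' ` (insert q (S - {p})) = S' \<and> (\<forall>t\<in>T. k' t = t)"
    using Suc.hyps(1)[OF c] Suc.prems by auto
  then obtain k' where k': "k' \<in> Q" "k' ` (insert q (S - {p})) = S'" "\<And>t. t \<in> T \<Longrightarrow> k' t = t"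
    by auto
  have "(k' \<circ> k) ` S = S'" using kS k' by (simp add: image_o del: image_comp o_apply)
  thus ?case using comp[OF k'(1) k(1)] k k' by (intro bexI[of _ "k' \<circ> k"]) auto
qed

text \<open>The double cosets of the stabilizer \<open>M\<close> of \<open>A\<close> are told apart by \<open>card (A - g ` A)\<close>. A subgroup \<open>H\<close>
  containing \<open>M\<close> and an element \<open>g\<close> moving \<open>m > 0\<close> points out of \<open>A\<close> contains the double coset of \<open>g\<close>; a set that
  differs from \<open>A\<close> in one exchange can be chosen at distance \<open>m\<close> from \<open>g ` A\<close>, so \<open>H\<close> contains all
  elements moving one point, and these generate the rest.\<close>

theorem maximal_stabilizer:
  fixes \<Gamma> :: "('a \<Rightarrow> 'a) set"
  assumes grp: "group (fun_group \<Gamma>)" and bij: "\<And>g. g \<in> \<Gamma> \<Longrightarrow> bij g"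
    and inf: "infinite A" and ne: "Ob - A \<noteq> {}"
    and bal: "\<And>g. g \<in> \<Gamma> \<Longrightarrow> finite (A - g ` A) \<and> finite (g ` A - A) \<and> card (A - g ` A) = card (g ` A - A)"
    and orb: "\<And>g. g \<in> \<Gamma> \<Longrightarrow> g ` A \<subseteq> Ob"
    and move: "\<And>p q T. finite T \<Longrightarrow> p \<noteq> q \<Longrightarrow> p \<notin> T \<Longrightarrow> q \<notin> T \<Longrightarrow> p \<in> A \<and> q \<in> A \<or> p \<in> Ob - A \<and> q \<in> Ob - A
       \<Longrightarrow> \<exists>k\<in>\<Gamma>. k ` A = A \<and> k p = q \<and> (\<forall>t\<in>T. k t = t)"
    and exch: "\<And>p q. p \<in> A \<Longrightarrow> q \<in> Ob - A \<Longrightarrow> \<exists>k\<in>\<Gamma>. k ` A = insert q (A - {p})"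
  shows "maximal_subgroup {g \<in> \<Gamma>. g ` A = A} (fun_group \<Gamma>)"
proof -
  interpret group "fun_group \<Gamma>" by fact
  define M where "M = {g \<in> \<Gamma>. g ` A = A}"
  have inv_eq: "inv\<^bsub>fun_group \<Gamma>\<^esub> g = inv_into UNIV g" if "g \<in> \<Gamma>" for g
    using fun_group_inv[OF grp that bij[OF that]] .
  have invG: "inv_into UNIV g \<in> \<Gamma>" if "g \<in> \<Gamma>" for g
    using inv_closed[of g] that inv_eq by simp
  have compG: "f \<circ> g \<in> \<Gamma>" if "f \<in> \<Gamma>" "g \<in> \<Gamma>" for f g using m_closed[of f g] that by simp
  have idG: "id \<in> \<Gamma>" using one_closed by simp
  have inv_im: "inv_into UNIV g ` (g ` B) = B" if "g \<in> \<Gamma>" for g B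
    using bij[OF that] by (simp add: bij_is_inj image_inv_f_f)
  have im_inv: "g ` (inv_into UNIV g ` B) = B" if "g \<in> \<Gamma>" for g B
    using bij[OF that] by (simp add: bij_is_surj image_f_inv_f)
  have Mcomp: "f \<circ> g \<in> M" if "f \<in> M" "g \<in> M" for f g
    using that compG[of f g] image_o[of f g A] by (auto simp: M_def simp del: image_comp)
  have Msub: "subgroup M (fun_group \<Gamma>)"
  proof (rule fun_subgroupI[OF grp])
    fix f assume "f \<in> M" thus "inv_into UNIV f \<in> M"
      unfolding M_def using invG inv_im[of f A] by auto
  next
    fix f g assume "f \<in> M" "g \<in> M"
    thus "f \<circ> g \<in> M" by (rule Mcomp)
  qed (auto simp: M_def idG bij)
  have imD: "g ` (B - C) = g ` B - g ` C" if "g \<in> \<Gamma>" for g B C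
    using bij[OF that] by (simp add: bij_is_inj image_set_diff)
  have cardim: "card (g ` B) = card B" if "g \<in> \<Gamma>" for g B
    using bij[OF that] by (meson bij_is_inj card_image inj_on_subset top_greatest)
  \<comment> \<open>\<open>M\<close> acts transitively on the translates of \<open>A\<close> at a
    given distance: \<open>k1\<close> carries the missing points inside \<open>A\<close> while
    fixing the extra ones, then \<open>k2\<close> carries the extra points inside
    \<open>Ob - A\<close> while fixing the missing ones in their final position.\<close>
  have trans: "\<exists>k\<in>M. k ` (g ` A) = g' ` A"
    if g: "g \<in> \<Gamma>" "g' \<in> \<Gamma>" and c: "card (A - g ` A) = card (A - g' ` A)" for g g'
  proof -
    have Mc: "id \<in> M" "\<And>f g. f \<in> M \<Longrightarrow> g \<in> M \<Longrightarrow> f \<circ> g \<in> M"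
      using Mcomp by (auto simp: M_def idG)
    have mvA: "\<exists>k\<in>M. k p = q \<and> (\<forall>t\<in>T. k t = t)"
      if "finite T" "p \<noteq> q" "p \<notin> T" "q \<notin> T" "p \<in> A" "q \<in> A" for p q T
      using move[OF that(1-4)] that(5,6) by (auto simp: M_def)
    have mvO: "\<exists>k\<in>M. k p = q \<and> (\<forall>t\<in>T. k t = t)"
      if "finite T" "p \<noteq> q" "p \<notin> T" "q \<notin> T" "p \<in> Ob - A" "q \<in> Ob - A" for p q T
      using move[OF that(1-4)] that(5,6) by (auto simp: M_def)
    have "\<exists>k\<in>M. k ` (A - g ` A) = A - g' ` A \<and> (\<forall>t\<in>(g ` A - A). k t = t)"
      by (rule exists_move_subset[where B = A, OF Mc mvA]) (use bal[OF g(1)] bal[OF g(2)] c in auto)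
    then obtain k1 where k1: "k1 \<in> M" "k1 ` (A - g ` A) = A - g' ` A" "\<And>t. t \<in> g ` A - A \<Longrightarrow> k1 t = t" by auto
    have "\<exists>k\<in>M. k ` (g ` A - A) = g' ` A - A \<and> (\<forall>t\<in>(A - g' ` A). k t = t)"
      by (rule exists_move_subset[where B = "Ob - A", OF Mc mvO])
         (use bal[OF g(1)] bal[OF g(2)] c orb[OF g(1)] orb[OF g(2)] in auto)
    then obtain k2 where k2: "k2 \<in> M" "k2 ` (g ` A - A) = g' ` A - A" "\<And>t. t \<in> A - g' ` A \<Longrightarrow> k2 t = t" by auto
    have k: "k2 \<circ> k1 \<in> M" using Mc k1 k2 by auto
    hence kG: "k2 \<circ> k1 \<in> \<Gamma>" and kA: "(k2 \<circ> k1) ` A = A" by (auto simp: M_def)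
    have 1: "(k2 \<circ> k1) ` (A - g ` A) = A - g' ` A"
    proof -
      have "k2 ` (A - g' ` A) = A - g' ` A" using k2(3) by force
      thus ?thesis using k1(2) by (simp add: image_o del: image_comp o_apply)
    qed
    have "k1 ` (g ` A - A) = g ` A - A" using k1(3) by force
    hence 2: "(k2 \<circ> k1) ` (g ` A - A) = g' ` A - A" using k2(2) by (simp add: image_o del: image_comp o_apply)
    have e: "C = (A - (A - C)) \<union> (C - A)" for C :: "'a set" by auto
    have "(k2 \<circ> k1) ` (g ` A) = (k2 \<circ> k1) ` ((A - (A - g ` A)) \<union> (g ` A - A))" using e[of "g ` A"] by simp
    also have "\<dots> = (A - (A - g' ` A)) \<union> (g' ` A - A)"
      using 1 2 kA imD[OF kG] by (simp only: image_Un)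
    also have "\<dots> = g' ` A" using e[of "g' ` A"] by simp
    finally show ?thesis using k by blast
  qed
  have all: "H = \<Gamma>" if H: "subgroup H (fun_group \<Gamma>)" and MH: "M \<subseteq> H" and ne: "H \<noteq> M" for H
  proof -
    interpret H: subgroup H "fun_group \<Gamma>" by fact
    have HG: "H \<subseteq> \<Gamma>" using H.subset by simp
    have Hc: "f \<circ> g \<in> H" if "f \<in> H" "g \<in> H" for f g using H.m_closed[OF that] by simp
    have Hi: "inv_into UNIV g \<in> H" if "g \<in> H" for g
      using H.m_inv_closed[OF that] inv_eq[of g] HG that by (metis subsetD)
    have cancel: "g \<in> H" if "g \<in> \<Gamma>" "k \<in> H" "inv_into UNIV k \<circ> g \<in> H" for g k
    proof -
      have "k \<circ> (inv_into UNIV k \<circ> g) = g"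
      proof
        have "surj k" using bij[of k] HG \<open>k \<in> H\<close> by (auto simp: bij_is_surj)
        thus "(k \<circ> (inv_into UNIV k \<circ> g)) z = g z" for z by (simp add: surj_f_inv_f)
      qed
      thus ?thesis using Hc[OF that(2,3)] by simp
    qed
    have empty_iff: "g ` A - A = {} \<longleftrightarrow> A - g ` A = {}" if "g \<in> \<Gamma>" for g
      using bal[OF that] by (metis card_0_eq)
    have same: "g' \<in> H" if "g \<in> H" "g' \<in> \<Gamma>" "card (A - g ` A) = card (A - g' ` A)" for g g'
    proof -
      have gG: "g \<in> \<Gamma>" using HG that by auto
      have "\<exists>k\<in>M. k ` (g ` A) = g' ` A" using trans[OF gG that(2,3)] .
      then obtain k where k: "k \<in> M" "k ` (g ` A) = g' ` A" by blast
      have kg: "k \<circ> g \<in> H" using k MH that Hc by auto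
      have kgG: "k \<circ> g \<in> \<Gamma>" using kg HG by auto
      have "(inv_into UNIV (k \<circ> g) \<circ> g') ` A = A"
        using k(2) inv_im[OF kgG, of A] by (simp add: image_o del: image_comp o_apply)
      hence "inv_into UNIV (k \<circ> g) \<circ> g' \<in> M" using compG[OF invG[OF kgG] that(2)] by (simp add: M_def)
      thus ?thesis using cancel[OF that(2) kg] MH by auto
    qed
    have dist_inv: "card (A - (inv_into UNIV k \<circ> g) ` A) = card (k ` A - g ` A)" if "k \<in> \<Gamma>" "g \<in> \<Gamma>" for k g
    proof -
      have "k ` (A - (inv_into UNIV k \<circ> g) ` A) = k ` A - g ` A"
        using imD[OF that(1)] im_inv[OF that(1)] by (simp add: image_o del: image_comp o_apply)
      thus ?thesis using cardim[OF that(1)] by metis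
    qed
    obtain g where g: "g \<in> H" "g \<notin> M" using ne MH by auto
    have gG: "g \<in> \<Gamma>" using g HG by auto
    note bg = bal[OF gG]
    have "g ` A \<noteq> A" using g gG by (auto simp: M_def)
    hence "g ` A - A \<noteq> {}" using empty_iff[OF gG] by auto
    then obtain b where b: "b \<in> g ` A" "b \<notin> A" by auto
    have "\<not> A \<subseteq> A - g ` A" using inf bg finite_subset by blast
    then obtain a where a: "a \<in> A" "a \<in> g ` A" by auto
    have bO: "b \<in> Ob - A" using b orb[OF gG] by auto
    \<comment> \<open>Both \<open>a\<close> and \<open>b\<close> lie in the image of
      \<open>A\<close> under \<open>g\<close>. Trading \<open>a\<close> for \<open>b\<close> turns
      \<open>b\<close> from a surplus point of that image into a common one and \<open>a\<close>
      from a common point into a surplus one, so the distance is unchanged.\<close>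
    obtain k where k: "k \<in> \<Gamma>" "k ` A = insert b (A - {a})" using exch[OF a(1) bO] by auto
    have "g ` A - k ` A = insert a ((g ` A - A) - {b})" using k(2) a b by auto
    hence "card (g ` A - k ` A) = card (g ` A - A)"
      using card_exchange[of "g ` A - A" b a] a b bg by simp
    hence "card (A - (inv_into UNIV g \<circ> k) ` A) = card (A - g ` A)" using dist_inv[OF gG k(1)] bg by simp
    hence "inv_into UNIV g \<circ> k \<in> H" using same[OF g(1) compG[OF invG[OF gG] k(1)]] by simp
    hence kH: "k \<in> H" using cancel[OF k(1) g(1)] by simp
    have ck: "card (A - k ` A) = 1"
    proof -
      have "A - k ` A = {a}" using k(2) a b by auto
      thus ?thesis by simp
    qed
    have one: "k' \<in> H" if "k' \<in> \<Gamma>" "card (A - k' ` A) = 1" for k'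
      using same[OF kH that(1)] ck that(2) by simp
    have "f \<in> H" if "f \<in> \<Gamma>" "card (A - f ` A) = n" for f n
      using that
    proof (induction n arbitrary: f)
      case 0
      hence "A - f ` A = {}" using bal[OF 0(1)] by (metis card_0_eq)
      moreover hence "f ` A - A = {}" using empty_iff[OF 0(1)] by blast
      ultimately have "f ` A = A" by auto
      thus ?case using 0 MH by (auto simp: M_def)
    next
      case (Suc n)
      note bf = bal[OF Suc.prems(1)]
      obtain p where p: "p \<in> A" "p \<notin> f ` A"
        using Suc.prems(2) by (metis Diff_iff card.empty ex_in_conv nat.simps(3))
      obtain q where q: "q \<in> f ` A" "q \<notin> A"
        using Suc.prems(2) bf by (metis Diff_iff card.empty ex_in_conv nat.simps(3))
      have qO: "q \<in> Ob - A" using q orb[OF Suc.prems(1)] by auto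
      \<comment> \<open>Undoing one exchange of a missing point \<open>p\<close> for an extra point
        \<open>q\<close> lowers the distance by one.\<close>
      obtain j where j: "j \<in> \<Gamma>" "j ` A = insert q (A - {p})" using exch[OF p(1) qO] by auto
      have "A - j ` A = {p}" using j(2) p q by auto
      hence jH: "j \<in> H" using one[OF j(1)] by simp
      have "j ` A - f ` A = (A - f ` A) - {p}" using j(2) p q by auto
      hence "card (j ` A - f ` A) = n" using Suc.prems(2) bf p by (simp add: card_Diff_singleton)
      hence "inv_into UNIV j \<circ> f \<in> H"
        using Suc.IH[OF compG[OF invG[OF j(1)] Suc.prems(1)]] dist_inv[OF j(1) Suc.prems(1)] by metis
      thus ?case using cancel[OF Suc.prems(1) jH] by simp
    qed
    thus ?thesis using HG by auto
  qed
  have "M \<noteq> \<Gamma>"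
  proof -
    obtain p where p: "p \<in> A" using inf by (metis ex_in_conv finite.emptyI)
    obtain q where q: "q \<in> Ob - A" using ne by auto
    obtain k where "k \<in> \<Gamma>" "k ` A = insert q (A - {p})" using exch[OF p q] by auto
    thus ?thesis using p q by (auto simp: M_def)
  qed
  thus ?thesis unfolding maximal_subgroup_def M_def[symmetric] using grp Msub all by auto
qed

section \<open>Topological preliminaries\<close>

lemma open_vimage_cont: "continuous_on UNIV f \<Longrightarrow> open S \<Longrightarrow> open (f -` S)"
  using continuous_on_open_vimage[of UNIV f] by auto

lemma closed_vimage_cont: "continuous_on UNIV f \<Longrightarrow> closed S \<Longrightarrow> closed (f -` S)"
  using open_vimage_cont[of f "- S"] by (simp add: closed_def vimage_Compl)

text \<open>A basic open set restricts finitely many coordinates and is an intersection of preimages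
  of subsets of the discrete two-point space, hence closed as well.\<close>

lemma cantor_clopen_basis:
  fixes f :: "nat \<Rightarrow> bool"
  assumes "open W" "f \<in> W"
  shows "\<exists>V. open V \<and> closed V \<and> f \<in> V \<and> V \<subseteq> W"
proof -
  have "openin (product_topology (\<lambda>_. euclidean) UNIV) W"
    using assms(1) by (simp add: open_fun_def)
  then obtain X where X: "f \<in> (\<Pi>\<^sub>E i\<in>UNIV. X i)" "finite {i. X i \<noteq> UNIV}" "(\<Pi>\<^sub>E i\<in>UNIV. X i) \<subseteq> W"
    using product_topology_open_contains_basis[of "\<lambda>_. euclidean" UNIV W f] assms(2) by auto
  have "open (Pi\<^sub>E UNIV X)" by (rule open_PiE) (use X(2) open_discrete in auto)
  moreover have "closed (Pi\<^sub>E UNIV X)"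
  proof -
    have "Pi\<^sub>E UNIV X = (\<Inter>i. (\<lambda>g. g i) -` X i)" by (auto simp: PiE_iff)
    moreover have "closed ((\<lambda>g :: nat \<Rightarrow> bool. g i) -` X i)" for i
      by (rule closed_vimage_cont[OF continuous_on_product_coordinates]) (simp add: closed_def open_discrete)
    ultimately show ?thesis by auto
  qed
  ultimately show ?thesis using X by blast
qed

lemma cantor_set_clopen_basis:
  fixes p :: "'a::topological_space"
  assumes "cantor_set (UNIV :: 'a set)" "open W" "p \<in> W"
  shows "\<exists>V. open V \<and> closed V \<and> p \<in> V \<and> V \<subseteq> W"
proof -
  obtain f :: "'a \<Rightarrow> nat \<Rightarrow> bool" and g where h: "homeomorphism UNIV UNIV f g"
    using assms(1) unfolding cantor_set_def homeomorphic_def by auto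
  have c: "continuous_on UNIV f" "continuous_on UNIV g" and gf: "\<And>y. g (f y) = y" "\<And>y. f (g y) = y"
    using h by (auto simp: homeomorphism_def)
  have "open (g -` W)" "f p \<in> g -` W" using open_vimage_cont[OF c(2)] assms gf by auto
  then obtain V where V: "open V" "closed V" "f p \<in> V" "V \<subseteq> g -` W"
    using cantor_clopen_basis by metis
  have "f -` V \<subseteq> W"
  proof
    fix z assume "z \<in> f -` V"
    hence "f z \<in> g -` W" using V(4) by auto
    thus "z \<in> W" using gf by simp
  qed
  thus ?thesis using V open_vimage_cont[OF c(1)] closed_vimage_cont[OF c(1)] by (intro exI[of _ "f -` V"]) auto
qed

lemma cantor_set_compact:
  assumes "cantor_set (UNIV :: 'a::topological_space set)"
  shows "compact (UNIV :: 'a set)"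
proof -
  have "compact_space (product_topology (\<lambda>i::nat. euclidean :: bool topology) UNIV)"
    unfolding compact_space_product_topology
    by (simp add: compact_space_def compactin_euclidean_iff finite_imp_compact)
  hence "compact (UNIV :: (nat \<Rightarrow> bool) set)"
    by (simp add: euclidean_product_topology compact_space_def)
  thus ?thesis using assms homeomorphic_compactness unfolding cantor_set_def by blast
qed

lemma cantor_set_infinite:
  assumes "cantor_set (UNIV :: 'a::topological_space set)"
  shows "infinite (UNIV :: 'a set)"
proof -
  have "infinite (UNIV :: (nat \<Rightarrow> bool) set)"
  proof
    assume "finite (UNIV :: (nat \<Rightarrow> bool) set)"
    hence "finite (UNIV :: nat set)" by (rule finite_fun_UNIVD1) (simp add: card_UNIV_bool)
    thus False by simp
  qed
  moreover obtain f :: "'a \<Rightarrow> nat \<Rightarrow> bool" where "range f = UNIV"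
    using assms unfolding cantor_set_def homeomorphic_def homeomorphism_def by blast
  ultimately show ?thesis by (metis finite_imageI)
qed

lemma continuous_int_open: "continuous_on UNIV (c :: 'a::topological_space \<Rightarrow> int) \<Longrightarrow> open {z. P (c z)}"
  using open_vimage_cont[of c "Collect P"] open_discrete by (auto simp: vimage_def)

lemma continuous_int_closed: "continuous_on UNIV (c :: 'a::topological_space \<Rightarrow> int) \<Longrightarrow> closed {z. P (c z)}"
  using continuous_int_open[of c "\<lambda>n. \<not> P n"] by (simp add: closed_def Collect_neg_eq)

lemma continuous_int_if:
  fixes a b :: "'a::topological_space \<Rightarrow> int"
  assumes "open V" "closed V" "continuous_on UNIV a" "continuous_on UNIV b"
  shows "continuous_on UNIV (\<lambda>z. if z \<in> V then a z else b z)"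
proof -
  have "open ((\<lambda>z. if z \<in> V then a z else b z) -` S)" for S
  proof -
    have "(\<lambda>z. if z \<in> V then a z else b z) -` S = (V \<inter> {z. a z \<in> S}) \<union> (- V \<inter> {z. b z \<in> S})"
      by (auto split: if_splits)
    moreover have "open {z. a z \<in> S}" "open {z. b z \<in> S}" "open (- V)"
      using continuous_int_open assms by (auto intro: continuous_int_open)
    ultimately show ?thesis using assms(1) by (simp add: open_Int open_Un)
  qed
  thus ?thesis by (simp add: continuous_on_open_vimage)
qed

lemma continuous_int_map:
  fixes c :: "'a::topological_space \<Rightarrow> int" and f :: "int \<Rightarrow> int"
  assumes "continuous_on UNIV c" shows "continuous_on UNIV (\<lambda>z. f (c z))"
  by (rule continuous_on_compose2[OF _ assms, of UNIV f]) (simp_all add: continuous_on_open_vimage open_discrete)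

lemma compact_int_image_bounded:
  fixes g :: "'b::topological_space \<Rightarrow> int"
  assumes "compact C" "continuous_on C g"
  shows "\<exists>N. g ` C \<subseteq> {- int N..int N}"
proof -
  have "compact (g ` C)" using compact_continuous_image[OF assms(2,1)] .
  moreover have "g ` C \<subseteq> (\<Union>n\<in>UNIV. {n})" by simp
  ultimately obtain M where "finite M" "g ` C \<subseteq> (\<Union>n\<in>M. {n})"
    using compactE_image[of "g ` C" UNIV "\<lambda>n. {n}"] open_discrete by metis
  hence "finite (g ` C)" by (simp add: finite_subset)
  hence fin: "finite (abs ` g ` C)" by simp
  show ?thesis
  proof (intro exI subsetI)
    fix i assume "i \<in> g ` C"
    hence "\<bar>i\<bar> \<le> Max (abs ` g ` C)" using fin by simp
    thus "i \<in> {- int (nat (Max (abs ` g ` C)))..int (nat (Max (abs ` g ` C)))}" by auto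
  qed
qed

section \<open>Integer powers of a bijection\<close>

lemma zpow_0 [simp]: "zpow f 0 z = z"
  by (simp add: zpow_def)

lemma zpow_1 [simp]: "zpow f 1 z = f z"
  by (simp add: zpow_def)

lemma zpow_of_nat: "zpow f (int n) z = (f ^^ n) z"
  by (simp add: zpow_def)

lemma zpow_plus_1:
  assumes "bij f" shows "zpow f (n + 1) z = f (zpow f n z)"
proof (cases "n \<ge> 0")
  case True
  thus ?thesis by (simp add: zpow_def nat_add_distrib)
next
  case False
  then obtain k where k: "n = - int (Suc k)" by (metis negD not_le)
  have "f (zpow f n z) = f (inv_into UNIV f ((inv_into UNIV f ^^ k) z))" unfolding k zpow_def by (simp add: nat_add_distrib)
  also have "\<dots> = (inv_into UNIV f ^^ k) z" using assms by (simp add: bij_is_surj surj_f_inv_f)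
  also have "\<dots> = zpow f (n + 1) z" unfolding k zpow_def by simp
  finally show ?thesis by simp
qed

lemma zpow_add:
  assumes "bij f" shows "zpow f (m + n) z = zpow f m (zpow f n z)"
proof (induction m rule: int_induct[where k = 0])
  case base thus ?case by simp
next
  case (step1 i)
  thus ?case using zpow_plus_1[OF assms, of "i + n" z] zpow_plus_1[OF assms, of i] by (simp add: algebra_simps)
next
  case (step2 i)
  have "f (zpow f (i - 1 + n) z) = f (zpow f (i - 1) (zpow f n z))"
    using step2 zpow_plus_1[OF assms, of "i - 1 + n" z] zpow_plus_1[OF assms, of "i - 1"] by (simp add: algebra_simps)
  thus ?case using assms by (simp add: bij_is_inj inj_eq)
qed

section \<open>Commensurate sets and the excess\<close>

definition excess :: "'a set \<Rightarrow> 'a set \<Rightarrow> int" where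
  "excess C D = int (card (C - D)) - int (card (D - C))"

definition commensurate :: "'a set \<Rightarrow> 'a set \<Rightarrow> bool" where
  "commensurate C D \<longleftrightarrow> finite (C - D) \<and> finite (D - C)"

text \<open>Intersecting with a finite \<open>F\<close> that contains both differences turns the
  excess into a difference of two cardinalities; one \<open>F\<close> for three sets makes it
  telescope in \<open>excess_add\<close>.\<close>

lemma excess_eq:
  assumes "finite F" "C - D \<subseteq> F" "D - C \<subseteq> F"
  shows "excess C D = int (card (C \<inter> F)) - int (card (D \<inter> F))"
proof -
  have 1: "card (C \<inter> F) = card (C - D) + card (C \<inter> D \<inter> F)"
    using assms by (subst card_Un_disjoint[symmetric]) (auto intro: finite_subset[of _ F] intro!: arg_cong[of _ _ card])
  have 2: "card (D \<inter> F) = card (D - C) + card (C \<inter> D \<inter> F)"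
    using assms by (subst card_Un_disjoint[symmetric]) (auto intro: finite_subset[of _ F] intro!: arg_cong[of _ _ card])
  show ?thesis unfolding excess_def 1 2 by simp
qed

lemma excess_add:
  assumes "commensurate C D" "commensurate D E"
  shows "excess C E = excess C D + excess D E"
proof -
  define F where "F = (C - D) \<union> (D - C) \<union> (D - E) \<union> (E - D)"
  have "finite F" using assms unfolding F_def commensurate_def by auto
  note e = excess_eq[OF this]
  have "excess C D = int (card (C \<inter> F)) - int (card (D \<inter> F))" by (rule e) (auto simp: F_def)
  moreover have "excess D E = int (card (D \<inter> F)) - int (card (E \<inter> F))" by (rule e) (auto simp: F_def)
  moreover have "excess C E = int (card (C \<inter> F)) - int (card (E \<inter> F))" by (rule e) (auto simp: F_def)
  ultimately show ?thesis by simp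
qed

lemma commensurate_refl [simp]: "commensurate C C"
  by (simp add: commensurate_def)

lemma commensurate_image: "inj f \<Longrightarrow> commensurate C D \<Longrightarrow> commensurate (f ` C) (f ` D)"
  unfolding commensurate_def by (simp add: image_set_diff[symmetric])

lemma excess_image:
  assumes "inj f" shows "excess (f ` C) (f ` D) = excess C D"
proof -
  have "card (f ` C - f ` D) = card (C - D)" for C D
    using assms by (metis card_image image_set_diff inj_on_subset subset_UNIV)
  thus ?thesis by (simp add: excess_def)
qed

lemma excess_self [simp]: "excess C C = 0"
  by (simp add: excess_def)

lemma excess_eq_0_iff: "excess C D = 0 \<longleftrightarrow> card (C - D) = card (D - C)"
  by (simp add: excess_def)

text \<open>The set \<open>I\<close> may include arguments where \<open>f\<close> vanishes; this
  replaces the support-dependent index set of \<open>pushforward\<close> by a fixed parametrisation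
  of the fibre.\<close>

lemma pushforward_eq_sum:
  assumes "finite I" "inj_on e I" "\<And>n. n \<in> I \<Longrightarrow> p (e n) = w"
    and "\<And>v. p v = w \<Longrightarrow> f v \<noteq> 0 \<Longrightarrow> v \<in> e ` I"
  shows "pushforward p f w = (\<Sum>n\<in>I. f (e n))"
proof -
  have "pushforward p f w = sum f (e ` I)"
    unfolding pushforward_def by (rule sum.mono_neutral_left) (use assms in auto)
  also have "\<dots> = (\<Sum>n\<in>I. f (e n))" using assms(2) by (simp add: sum.reindex)
  finally show ?thesis .
qed

section \<open>Minimal homeomorphisms of Cantor sets\<close>

locale minimal_cantor =
  fixes \<phi> :: "'a::t2_space \<Rightarrow> 'a" and x :: 'a
  assumes cantor: "cantor_set (UNIV :: 'a set)"
    and homeo: "self_homeo \<phi>"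
    and minim: "minimal \<phi>"
begin

abbreviation P :: "int \<Rightarrow> 'a \<Rightarrow> 'a" where "P \<equiv> zpow \<phi>"

lemma bij_phi: "bij \<phi>"
  using homeo unfolding self_homeo_def homeomorphism_def
  by (metis UNIV_I bijI' )

lemma P_add: "P m (P n z) = P (m + n) z"
  using zpow_add[OF bij_phi] by simp

lemma P_eq_iff: "P n y = z \<longleftrightarrow> y = P (- n) z"
  using P_add[of "- n" n y] P_add[of n "- n" z] by auto

lemma P_inj [simp]: "P n y = P n z \<longleftrightarrow> y = z"
  by (simp add: P_eq_iff P_add)

lemma P_continuous: "continuous_on UNIV (P n)"
proof -
  have c: "continuous_on UNIV \<phi>" "continuous_on UNIV (inv_into UNIV \<phi>)"
    using homeo unfolding self_homeo_def homeomorphism_def by auto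
  have "continuous_on UNIV (f ^^ k)" if "continuous_on UNIV f" for f :: "'a \<Rightarrow> 'a" and k
  proof (induction k)
    case (Suc k)
    thus ?case using continuous_on_compose2[of UNIV f UNIV "f ^^ k"] that by (simp add: comp_def)
  qed (simp add: id_def)
  thus ?thesis unfolding zpow_def using c by auto
qed

lemma open_P: "open W \<Longrightarrow> open {z. P n z \<in> W}"
  using open_vimage_cont[OF P_continuous] by (simp add: vimage_def)

lemma closed_P: "closed W \<Longrightarrow> closed {z. P n z \<in> W}"
  using closed_vimage_cont[OF P_continuous] by (simp add: vimage_def)

lemma compact_UNIV: "compact (UNIV :: 'a set)"
  using cantor_set_compact[OF cantor] .

lemma orbit_meets:
  assumes "open W" "W \<noteq> {}" shows "\<exists>n. P n z \<in> W"
proof -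
  have "closure (range (\<lambda>n. P n z)) = UNIV" using minim unfolding minimal_def by auto
  thus ?thesis using assms open_Int_closure_eq_empty[OF assms(1), of "range (\<lambda>n. P n z)"] by auto
qed

text \<open>A periodic orbit is finite, hence closed, hence the whole space by minimality, while a
  Cantor set is infinite. Freeness makes the integer in \<open>coc\<close> unique.\<close>

lemma P_free:
  assumes "P n z = z" shows "n = 0"
proof (rule ccontr)
  assume n: "n \<noteq> 0"
  have per: "P (k * n) z = z" for k
  proof (induction k rule: int_induct[where k = 0])
    case (step1 i) thus ?case using assms P_add[of "i * n" n z] by (simp add: algebra_simps)
  next
    case (step2 i)
    have "P (i * n - n) z = P (i * n - n) (P n z)" using assms by simp
    also have "\<dots> = z" using step2 by (simp add: P_add)
    finally show ?case by (simp add: algebra_simps)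
  qed simp
  have "P m z \<in> (\<lambda>i. P i z) ` {0..<\<bar>n\<bar>}" for m
  proof -
    have "P m z = P (m mod \<bar>n\<bar>) (P ((m div \<bar>n\<bar>) * \<bar>n\<bar>) z)"
      unfolding P_add by (simp add: mod_mult_div_eq mult.commute)
    also have "P ((m div \<bar>n\<bar>) * \<bar>n\<bar>) z = z"
      using per[of "(m div \<bar>n\<bar>) * sgn n"] by (simp add: abs_sgn mult.assoc mult.commute[of "sgn n"])
    finally show ?thesis using n by auto
  qed
  hence "finite (range (\<lambda>m. P m z))" using finite_subset[of "range (\<lambda>m. P m z)" "(\<lambda>i. P i z) ` {0..<\<bar>n\<bar>}"] by auto
  hence "range (\<lambda>m. P m z) = UNIV"
    using minim unfolding minimal_def by (metis closure_closed finite_imp_closed)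
  thus False using \<open>finite (range _)\<close> cantor_set_infinite[OF cantor] by simp
qed

lemma P_index_inj [simp]: "P m z = P n z \<longleftrightarrow> m = n"
proof
  assume "P m z = P n z"
  hence "P (m - n) z = z" using P_eq_iff[of n z] by (metis P_add P_eq_iff add.commute add_uminus_conv_diff)
  thus "m = n" using P_free by fastforce
qed simp

lemma clopen_basis: "open (W :: 'a set) \<Longrightarrow> p \<in> W \<Longrightarrow> \<exists>V. open V \<and> closed V \<and> p \<in> V \<and> V \<subseteq> W"
  by (rule cantor_set_clopen_basis[OF cantor])

text \<open>Compactness yields finitely many times, possibly negative, of absolute value at most
  \<open>L\<close>; starting from \<open>P (L + 1) z\<close> makes them all positive.\<close>

lemma recurrence:
  assumes "open W" "W \<noteq> {}"
  obtains N :: nat where "\<And>z. \<exists>i\<in>{1..N}. P (int i) z \<in> W"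
proof -
  have "\<exists>M. finite M \<and> (UNIV :: 'a set) \<subseteq> (\<Union>n\<in>M. {z. P n z \<in> W})"
    using compactE_image[OF compact_UNIV, of UNIV "\<lambda>n. {z. P n z \<in> W}"] open_P[OF assms(1)] orbit_meets[OF assms]
    by (metis (mono_tags, lifting) UNIV_I UN_iff mem_Collect_eq subsetI)
  then obtain M where M: "finite M" "\<And>z. \<exists>n\<in>M. P n z \<in> W" by fastforce
  define L where "L = (\<Sum>n\<in>M. \<bar>n\<bar>)"
  have L: "\<bar>n\<bar> \<le> L" if "n \<in> M" for n
    unfolding L_def using member_le_sum[OF that, of abs] M(1) by simp
  have "\<exists>i\<in>{1..nat (2 * L + 1)}. P (int i) z \<in> W" for z
  proof -
    obtain n where n: "n \<in> M" "P n (P (L + 1) z) \<in> W" using M(2) by blast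
    have "nat (n + (L + 1)) \<in> {1..nat (2 * L + 1)}" "int (nat (n + (L + 1))) = n + (L + 1)"
      using L[OF n(1)] by auto
    thus ?thesis using n(2) unfolding P_add by metis
  qed
  thus thesis using that by blast
qed

section \<open>Topological full groups\<close>

definition coc :: "('a \<Rightarrow> 'a) \<Rightarrow> 'a \<Rightarrow> int" where
  "coc \<alpha> z = (THE n. \<alpha> z = P n z)"

lemma cocI: "\<alpha> z = P n z \<Longrightarrow> coc \<alpha> z = n"
  unfolding coc_def by (rule the_equality) auto

text \<open>The full group of \<open>G\<close> in terms of orbit cocycles. Continuity of the map and
  of its inverse is a consequence, by compactness for the inverse.\<close>

definition FG :: "('a \<Rightarrow> 'a) set" where
  "FG = {\<alpha>. bij \<alpha> \<and> (\<forall>z. \<alpha> z = P (coc \<alpha> z) z) \<and> continuous_on UNIV (coc \<alpha>)}"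

lemma FGI:
  assumes "bij \<alpha>" "\<And>z. \<alpha> z = P (c z) z" "continuous_on UNIV c"
  shows "\<alpha> \<in> FG"
proof -
  have "coc \<alpha> = c" using assms(2) cocI by blast
  thus ?thesis using assms by (simp add: FG_def)
qed

lemma FG_bij: "\<alpha> \<in> FG \<Longrightarrow> bij \<alpha>"
  and FG_coc: "\<alpha> \<in> FG \<Longrightarrow> P (coc \<alpha> z) z = \<alpha> z"
  and FG_cont_coc: "\<alpha> \<in> FG \<Longrightarrow> continuous_on UNIV (coc \<alpha>)"
  by (auto simp: FG_def)

lemma continuous_P_coc:
  assumes "continuous_on UNIV c" shows "continuous_on UNIV (\<lambda>z. P (c z) z)"
proof -
  have "open ((\<lambda>z. P (c z) z) -` W)" if "open W" for W
  proof -
    have "(\<lambda>z. P (c z) z) -` W = (\<Union>n. {z. c z = n} \<inter> {z. P n z \<in> W})" by auto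
    moreover have "open ({z. c z = n} \<inter> {z. P n z \<in> W})" for n
      by (intro open_Int continuous_int_open[OF assms] open_P[OF that])
    ultimately show ?thesis by auto
  qed
  thus ?thesis using continuous_on_open_vimage[of UNIV "\<lambda>z. P (c z) z"] by auto
qed

lemma FG_continuous: "\<alpha> \<in> FG \<Longrightarrow> continuous_on UNIV \<alpha>"
  using continuous_P_coc[OF FG_cont_coc] FG_coc by (simp add: fun_eq_iff cong: continuous_on_cong)

lemma FG_inv_continuous:
  assumes "\<alpha> \<in> FG" shows "continuous_on UNIV (inv_into UNIV \<alpha>)"
proof -
  have "continuous_on (\<alpha> ` UNIV) (inv_into UNIV \<alpha>)"
    by (rule continuous_on_inv[OF FG_continuous[OF assms] compact_UNIV])
       (simp add: FG_bij[OF assms] bij_is_inj)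
  thus ?thesis using FG_bij[OF assms] by (simp add: bij_is_surj)
qed

lemma id_FG: "id \<in> FG"
  by (rule FGI[where c = "\<lambda>_. 0"]) auto

lemma coc_id [simp]: "coc id z = 0"
  by (rule cocI) simp

lemma coc_comp:
  assumes "\<alpha> \<in> FG" "\<beta> \<in> FG" shows "coc (\<alpha> \<circ> \<beta>) z = coc \<alpha> (\<beta> z) + coc \<beta> z"
  by (rule cocI) (metis FG_coc[OF assms(1)] FG_coc[OF assms(2)] P_add comp_apply)

lemma comp_FG:
  assumes "\<alpha> \<in> FG" "\<beta> \<in> FG" shows "\<alpha> \<circ> \<beta> \<in> FG"
proof (rule FGI)
  show "bij (\<alpha> \<circ> \<beta>)" using assms FG_bij bij_comp by blast
  show "(\<alpha> \<circ> \<beta>) z = P (coc \<alpha> (\<beta> z) + coc \<beta> z) z" for z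
    by (metis FG_coc[OF assms(1)] FG_coc[OF assms(2)] P_add comp_apply)
  have "continuous_on UNIV (\<lambda>z. coc \<alpha> (\<beta> z))"
    by (rule continuous_on_compose2[OF FG_cont_coc[OF assms(1)] FG_continuous[OF assms(2)]]) simp
  thus "continuous_on UNIV (\<lambda>z. coc \<alpha> (\<beta> z) + coc \<beta> z)"
    using FG_cont_coc[OF assms(2)] by (intro continuous_intros)
qed

lemma inv_FG:
  assumes "\<alpha> \<in> FG" shows "inv_into UNIV \<alpha> \<in> FG"
proof (rule FGI)
  note b = FG_bij[OF assms]
  show "bij (inv_into UNIV \<alpha>)" using b by (rule bij_imp_bij_inv)
  show "inv_into UNIV \<alpha> z = P (- coc \<alpha> (inv_into UNIV \<alpha> z)) z" for z
    using FG_coc[OF assms, of "inv_into UNIV \<alpha> z"] b P_eq_iff by (simp add: bij_is_surj surj_f_inv_f)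
  have "continuous_on UNIV (\<lambda>z. coc \<alpha> (inv_into UNIV \<alpha> z))"
    by (rule continuous_on_compose2[OF FG_cont_coc[OF assms] FG_inv_continuous[OF assms]]) simp
  from open_vimage_cont[OF this, of "uminus -` S" for S]
  show "continuous_on UNIV (\<lambda>z. - coc \<alpha> (inv_into UNIV \<alpha> z))"
    by (auto simp: continuous_on_open_vimage vimage_def open_discrete)
qed

lemma group_FG: "group (fun_group FG)"
  by (rule fun_groupI) (auto simp: id_FG comp_FG FG_bij inv_FG)

lemma FG_bounded:
  assumes "\<alpha> \<in> FG" obtains N :: nat where "\<And>z. \<bar>coc \<alpha> z\<bar> \<le> int N"
proof -
  obtain N where "range (coc \<alpha>) \<subseteq> {- int N..int N}"
    using compact_int_image_bounded[OF compact_UNIV FG_cont_coc[OF assms]] by blast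
  hence "coc \<alpha> z \<in> {- int N..int N}" for z by blast
  hence "\<bar>coc \<alpha> z\<bar> \<le> int N" for z by (simp add: abs_le_iff minus_le_iff)
  thus thesis using that by blast
qed

section \<open>The forward orbit and the index as a count of crossings\<close>

abbreviation A :: "'a set" where "A \<equiv> forward_orbit \<phi> x"

definition orbit :: "'a set" where "orbit = range (\<lambda>n. P n x)"

lemma P_in_A [simp]: "P n x \<in> A \<longleftrightarrow> n \<ge> 1"
proof
  assume "P n x \<in> A"
  then obtain k where "k \<ge> 1" "P n x = P (int k) x"
    unfolding forward_orbit_def by (auto simp: zpow_of_nat)
  thus "n \<ge> 1" by simp
next
  assume "n \<ge> 1"
  hence "P n x = (\<phi> ^^ nat n) x" "nat n \<ge> 1" by (auto simp: zpow_of_nat[symmetric])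
  thus "P n x \<in> A" unfolding forward_orbit_def by blast
qed

lemma A_obtain: "z \<in> A \<Longrightarrow> \<exists>n\<ge>1. z = P n x"
  unfolding forward_orbit_def by (auto simp: zpow_of_nat[symmetric] intro: exI[of _ "int _"])

lemma A_subset_orbit: "A \<subseteq> orbit"
  using A_obtain unfolding orbit_def by blast

lemma P_in_orbit [simp]: "P n z \<in> orbit \<longleftrightarrow> z \<in> orbit"
  unfolding orbit_def by (auto simp: P_eq_iff[of n z] P_add)

lemma FG_orbit: "\<alpha> \<in> FG \<Longrightarrow> \<alpha> z \<in> orbit \<longleftrightarrow> z \<in> orbit"
  using FG_coc[of \<alpha> z] by (metis P_in_orbit)

lemma infinite_A: "infinite A"
proof -
  have "(\<lambda>n. P n x) ` {1..} \<subseteq> A" by auto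
  moreover have "infinite ((\<lambda>n. P n x) ` {1::int..})"
    using infinite_Ici by (subst finite_image_iff) (auto intro: inj_onI)
  ultimately show ?thesis using finite_subset by blast
qed

text \<open>If the cocycle is bounded by \<open>N\<close>, only points within \<open>N\<close> steps
  of the cut between \<open>x\<close> and \<open>P 1 x\<close> can change sides.\<close>

lemma FG_commensurate:
  assumes "\<alpha> \<in> FG" shows "commensurate (\<alpha> ` A) A"
proof -
  obtain N where N: "\<And>z. \<bar>coc \<alpha> z\<bar> \<le> int N" using FG_bounded[OF assms] by blast
  have "\<alpha> ` A - A \<subseteq> (\<lambda>j. P j x) ` {1 - int N..0}"
  proof
    fix z assume z: "z \<in> \<alpha> ` A - A"
    then obtain i where i: "i \<ge> 1" "z = \<alpha> (P i x)" using A_obtain by blast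
    have "z = P (coc \<alpha> (P i x) + i) x" using i FG_coc[OF assms] by (metis P_add)
    moreover from this have "coc \<alpha> (P i x) + i \<le> 0" using z by auto
    moreover have "1 - int N \<le> coc \<alpha> (P i x) + i" using N[of "P i x"] i by linarith
    ultimately show "z \<in> (\<lambda>j. P j x) ` {1 - int N..0}" by auto
  qed
  moreover have "A - \<alpha> ` A \<subseteq> (\<lambda>j. P j x) ` {1..int N}"
  proof
    fix z assume z: "z \<in> A - \<alpha> ` A"
    then obtain j where j: "j \<ge> 1" "z = P j x" using A_obtain by blast
    obtain w where w: "z = \<alpha> w" using bij_is_surj[OF FG_bij[OF assms]] by (metis surjD)
    have "w \<in> orbit" using w z A_subset_orbit FG_orbit[OF assms] by blast
    then obtain i where i: "w = P i x" unfolding orbit_def by auto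
    have "P j x = P (coc \<alpha> w + i) x" using i j w FG_coc[OF assms] by (metis P_add)
    hence "j = coc \<alpha> w + i" by simp
    moreover have "i \<le> 0" using z w i by force
    ultimately have "j \<le> int N" using N[of w] by linarith
    thus "z \<in> (\<lambda>j. P j x) ` {1..int N}" using j by auto
  qed
  ultimately show ?thesis unfolding commensurate_def by (meson finite_atLeastAtMost_int finite_imageI finite_subset)
qed

definition ind :: "('a \<Rightarrow> 'a) \<Rightarrow> int" where "ind \<alpha> = excess (\<alpha> ` A) A"

lemma ind_comp:
  assumes "\<alpha> \<in> FG" "\<beta> \<in> FG" shows "ind (\<alpha> \<circ> \<beta>) = ind \<alpha> + ind \<beta>"
proof -
  have i: "inj \<alpha>" using FG_bij[OF assms(1)] bij_is_inj by blast
  have "ind (\<alpha> \<circ> \<beta>) = excess (\<alpha> ` \<beta> ` A) (\<alpha> ` A) + excess (\<alpha> ` A) A"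
    unfolding ind_def image_o
    by (rule excess_add) (use FG_commensurate assms commensurate_image[OF i] in auto)
  thus ?thesis unfolding ind_def excess_image[OF i] by simp
qed

lemma ind_id [simp]: "ind id = 0"
  by (simp add: ind_def)

lemma ind_inv:
  assumes "\<alpha> \<in> FG" shows "ind (inv_into UNIV \<alpha>) = - ind \<alpha>"
proof -
  have "inv_into UNIV \<alpha> \<circ> \<alpha> = id" using FG_bij[OF assms] by (simp add: bij_is_inj)
  thus ?thesis using ind_comp[OF inv_FG[OF assms] assms] by simp
qed

section \<open>Full bisections and cocycles\<close>

definition bis :: "('a \<Rightarrow> 'a) \<Rightarrow> ('a \<times> int) set" where
  "bis \<alpha> = range (\<lambda>z. (\<alpha> z, coc \<alpha> z))"

text \<open>\<open>G\<close> and \<open>K\<close> differ only in their arrows, so the bisections of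
  both can be treated at once.\<close>

definition like_G :: "('a \<times> int, 'a) groupoid \<Rightarrow> bool" where
  "like_G L \<longleftrightarrow> rng L = (\<lambda>(y, n). y) \<and> src L = (\<lambda>(y, n). P (- n) y)"

lemma continuous_src: "continuous_on UNIV (\<lambda>(y, n). P (- n) y)"
proof -
  have "open ((\<lambda>(y, n). P (- n) y) -` W)" if "open W" for W
  proof -
    have "(\<lambda>(y, n). P (- n) y) -` W = (\<Union>n. {y. P (- n) y \<in> W} \<times> {n})" by auto
    moreover have "open ({y. P (- n) y \<in> W} \<times> {n})" for n
      using open_Times[OF open_P[OF that] open_discrete] .
    ultimately show ?thesis by auto
  qed
  thus ?thesis using continuous_on_open_vimage[of UNIV "\<lambda>(y, n). P (- n) y"] by auto
qed

text \<open>On the compact set \<open>U\<close> the injective continuous source map has a continuous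
  inverse \<open>g\<close>. The arrow \<open>g z\<close> starts at \<open>z\<close>, and its integer
  coordinate is the cocycle of \<open>theta L U\<close> at \<open>z\<close>.\<close>

lemma full_bisection_FG:
  assumes L: "like_G L" and U: "full_bisection L U"
  shows "theta L U \<in> FG \<and> bis (theta L U) = U"
proof -
  define g where "g = inv_into U (src L)"
  have sU: "inj_on (src L) U" "src L ` U = UNIV" and rU: "inj_on (rng L) U" "rng L ` U = UNIV" and cU: "compact U"
    using U by (auto simp: full_bisection_def)
  have gU: "g z \<in> U" and sg: "src L (g z) = z" for z
    using sU inv_into_into[of z "src L" U] f_inv_into_f[of z "src L" U] by (auto simp: g_def)
  have gs: "g (src L u) = u" if "u \<in> U" for u using sU that by (simp add: g_def)
  have th: "theta L U z = fst (g z)" for z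
    using L by (auto simp: theta_def g_def like_G_def split: prod.splits)
  have eq: "theta L U z = P (snd (g z)) z" for z
  proof -
    have "P (- snd (g z)) (fst (g z)) = z" using sg[of z] L by (simp add: like_G_def split_beta)
    thus ?thesis unfolding th by (simp add: P_eq_iff)
  qed
  have "continuous_on U (src L)"
    using continuous_src L by (auto simp: like_G_def intro: continuous_on_subset)
  hence "continuous_on (src L ` U) g" using continuous_on_inv[OF _ cU] gs by blast
  hence cg: "continuous_on UNIV (\<lambda>z. snd (g z))" using sU(2) by (auto intro: continuous_on_snd)
  have "bij (theta L U)"
  proof (rule bijI)
    show "inj (theta L U)"
    proof (rule injI)
      fix z w assume "theta L U z = theta L U w"
      hence "rng L (g z) = rng L (g w)" using th L by (simp add: like_G_def split_beta)
      hence "g z = g w" using rU(1) gU by (meson inj_onD)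
      thus "z = w" using sg by metis
    qed
    have "y \<in> range (theta L U)" for y
    proof -
      obtain u where u: "u \<in> U" "rng L u = y" using rU(2) by (metis UNIV_I imageE)
      hence "theta L U (src L u) = y" using gs[OF u(1)] th L by (simp add: like_G_def split_beta)
      thus ?thesis by blast
    qed
    thus "surj (theta L U)" by auto
  qed
  hence 1: "theta L U \<in> FG" using FGI[OF _ eq cg] by blast
  have "coc (theta L U) z = snd (g z)" for z using cocI[OF eq] .
  hence "bis (theta L U) = range g" unfolding bis_def th by simp
  also have "range g = U"
  proof (intro subset_antisym subsetI)
    fix u assume "u \<in> U"
    from gs[OF this] show "u \<in> range g" by (metis rangeI)
  qed (use gU in blast)
  finally show ?thesis using 1 by blast
qed

lemma bis_iff: "\<alpha> \<in> FG \<Longrightarrow> (y, m) \<in> bis \<alpha> \<longleftrightarrow> coc \<alpha> (P (- m) y) = m"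
  unfolding bis_def using FG_coc by (auto simp: P_eq_iff[symmetric] image_iff; metis P_eq_iff add.inverse_inverse)

text \<open>Since \<open>src\<close> sends \<open>(y, n)\<close> to \<open>P (- n) y\<close>, the
  pair \<open>(\<alpha> z, coc \<alpha> z)\<close> is the arrow from \<open>z\<close> to
  \<open>\<alpha> z\<close>. Openness of \<open>bis \<alpha>\<close> comes from the open level sets
  of the cocycle, compactness from its being a continuous image of the space.\<close>

lemma FG_full_bisection:
  assumes \<alpha>: "\<alpha> \<in> FG" and L: "like_G L" and sub: "bis \<alpha> \<subseteq> arrows L"
  shows "full_bisection L (bis \<alpha>) \<and> theta L (bis \<alpha>) = \<alpha>"
proof -
  have "continuous_on UNIV (\<lambda>z. (\<alpha> z, coc \<alpha> z))"
    using FG_continuous[OF \<alpha>] FG_cont_coc[OF \<alpha>] by (intro continuous_on_Pair)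
  hence comp: "compact (bis \<alpha>)" unfolding bis_def using compact_UNIV compact_continuous_image by blast
  have "bis \<alpha> = (\<Union>m. {y. P (- m) y \<in> {z. coc \<alpha> z = m}} \<times> {m})" using bis_iff[OF \<alpha>] by auto
  moreover have "open ({y. P (- m) y \<in> {z. coc \<alpha> z = m}} \<times> {m})" for m
    using open_Times[OF open_P[OF continuous_int_open[OF FG_cont_coc[OF \<alpha>]]] open_discrete] .
  ultimately have "open (bis \<alpha>)" by auto
  hence op: "openin (top_of_set (arrows L)) (bis \<alpha>)" using sub by (auto simp: openin_open)
  have r: "rng L (\<alpha> z, n) = \<alpha> z" and s: "src L (\<alpha> z, coc \<alpha> z) = z" for z n
    using L FG_coc[OF \<alpha>, of z] P_eq_iff[of "coc \<alpha> z" z "\<alpha> z"] by (auto simp: like_G_def)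
  have injs: "inj_on (src L) (bis \<alpha>)" unfolding bis_def by (rule inj_onI) (auto simp: s)
  have injr: "inj_on (rng L) (bis \<alpha>)" unfolding bis_def
    using FG_bij[OF \<alpha>] by (auto intro!: inj_onI simp: r bij_is_inj inj_eq)
  have "rng L ` bis \<alpha> = UNIV" "src L ` bis \<alpha> = UNIV" unfolding bis_def
    using FG_bij[OF \<alpha>] by (auto simp: image_image r s bij_is_surj)
  hence fb: "full_bisection L (bis \<alpha>)" unfolding full_bisection_def using sub comp op injs injr by auto
  have "inv_into (bis \<alpha>) (src L) z = (\<alpha> z, coc \<alpha> z)" for z
    by (rule inv_into_f_eq[OF injs]) (auto simp: bis_def s)
  hence "theta L (bis \<alpha>) = \<alpha>" unfolding theta_def by (auto simp: r)
  thus ?thesis using fb by blast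
qed

abbreviation G :: "('a \<times> int, 'a) groupoid" where "G \<equiv> transformation_groupoid \<phi>"
abbreviation K :: "('a \<times> int, 'a) groupoid" where "K \<equiv> orbit_breaking \<phi> x"

definition FK :: "('a \<Rightarrow> 'a) set" where "FK = {\<alpha> \<in> FG. \<alpha> ` A = A}"

lemma FK_iff: "\<alpha> \<in> FK \<longleftrightarrow> \<alpha> \<in> FG \<and> (\<forall>z. \<alpha> z \<in> A \<longleftrightarrow> z \<in> A)"
proof -
  have "\<alpha> ` A = A \<longleftrightarrow> (\<forall>z. \<alpha> z \<in> A \<longleftrightarrow> z \<in> A)" if "bij \<alpha>"
  proof
    assume "\<alpha> ` A = A" thus "\<forall>z. \<alpha> z \<in> A \<longleftrightarrow> z \<in> A"
      using that by (metis bij_is_inj image_eqI inj_image_mem_iff)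
  next
    assume h: "\<forall>z. \<alpha> z \<in> A \<longleftrightarrow> z \<in> A"
    show "\<alpha> ` A = A"
    proof (intro subset_antisym subsetI)
      fix y assume y: "y \<in> A"
      have "surj \<alpha>" using that by (rule bij_is_surj)
      then obtain z where "\<alpha> z = y" by (metis surjD)
      thus "y \<in> \<alpha> ` A" using h y by blast
    qed (use h in auto)
  qed
  thus ?thesis unfolding FK_def using FG_bij by blast
qed

lemma like_G_G: "like_G G" and like_G_K: "like_G K"
  by (auto simp: like_G_def transformation_groupoid_def orbit_breaking_def Let_def)

lemma arrows_G [simp]: "arrows G = UNIV"
  by (simp add: transformation_groupoid_def)

lemma bis_subset_K: "\<alpha> \<in> FG \<Longrightarrow> bis \<alpha> \<subseteq> arrows K \<longleftrightarrow> \<alpha> \<in> FK"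
proof -
  assume a: "\<alpha> \<in> FG"
  have "(\<alpha> z, coc \<alpha> z) \<in> arrows K \<longleftrightarrow> (\<alpha> z \<in> A \<longleftrightarrow> z \<in> A)" for z
    using FG_coc[OF a, of z] P_eq_iff[of "coc \<alpha> z" z "\<alpha> z"]
    by (auto simp: orbit_breaking_def transformation_groupoid_def Let_def)
  thus ?thesis unfolding FK_iff bis_def using a by auto
qed

lemma carrier_full_group_G: "carrier (full_group G) = FG"
proof -
  have "\<alpha> \<in> FG" if "\<alpha> \<in> carrier (full_group G)" for \<alpha>
    using that full_bisection_FG[OF like_G_G] by (auto simp: full_group_def)
  moreover have "\<alpha> \<in> carrier (full_group G)" if "\<alpha> \<in> FG" for \<alpha>
    using FG_full_bisection[OF that like_G_G] by (auto simp: full_group_def intro: exI[of _ "bis \<alpha>"])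
  ultimately show ?thesis by blast
qed

lemma carrier_full_group_K: "carrier (full_group K) = FK"
proof -
  have "\<alpha> \<in> FK" if "\<alpha> \<in> carrier (full_group K)" for \<alpha>
  proof -
    from that obtain U where U: "full_bisection K U" "\<alpha> = theta K U" by (auto simp: full_group_def)
    thus ?thesis using full_bisection_FG[OF like_G_K U(1)] bis_subset_K[of \<alpha>] by (auto simp: full_bisection_def)
  qed
  moreover have "\<alpha> \<in> carrier (full_group K)" if "\<alpha> \<in> FK" for \<alpha>
  proof -
    have a: "\<alpha> \<in> FG" using that by (simp add: FK_def)
    show ?thesis
      using FG_full_bisection[OF a like_G_K] bis_subset_K[OF a] that by (auto simp: full_group_def intro: exI[of _ "bis \<alpha>"])
  qed
  ultimately show ?thesis by blast
qed

lemma full_group_G: "full_group G = fun_group FG" and full_group_K: "full_group K = fun_group FK"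
  using carrier_full_group_G carrier_full_group_K by (auto simp: full_group_def)

lemma the_bisection: "\<alpha> \<in> FG \<Longrightarrow> (THE U. full_bisection G U \<and> theta G U = \<alpha>) = bis \<alpha>"
  using FG_full_bisection[OF _ like_G_G] full_bisection_FG[OF like_G_G] by (intro the_equality) auto

lemma subgroup_FK: "subgroup FK (fun_group FG)"
proof (rule fun_subgroupI[OF group_FG])
  fix f assume f: "f \<in> FK"
  hence b: "bij f" and fG: "f \<in> FG" using FG_bij by (auto simp: FK_def)
  have "inv_into UNIV f z \<in> A \<longleftrightarrow> z \<in> A" for z
    using f b unfolding FK_iff by (metis bij_is_surj surj_f_inv_f)
  thus "inv_into UNIV f \<in> FK" using inv_FG[OF fG] FK_iff by blast
qed (auto simp: FK_iff id_FG comp_FG FG_bij)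

lemma group_FK: "group (fun_group FK)"
  using group.subgroup_imp_group[OF group_FG subgroup_FK] by simp

section \<open>The commutator subgroups\<close>

abbreviation "DG \<equiv> commutator_group G"
abbreviation "DK \<equiv> commutator_group K"

lemma DG_eq: "DG = derived (fun_group FG) FG" and DK_eq: "DK = derived (fun_group FK) FK"
  unfolding commutator_group_def full_group_G full_group_K by simp_all

text \<open>With \<open>fun_group FG\<close> as the one ambient group, the two derived subgroups can
  be compared.\<close>

lemma DK_eq': "DK = derived (fun_group FG) FK"
  using group.derived_consistent[OF group_FG _ subgroup_FK, of FK] DK_eq by simp

lemma subgroup_DG: "subgroup DG (fun_group FG)" and subgroup_DK: "subgroup DK (fun_group FG)"
  unfolding DG_eq DK_eq' by (rule group.derived_is_subgroup[OF group_FG]; use FK_def in auto)+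

lemma DK_subset_DG: "DK \<subseteq> DG"
  unfolding DG_eq DK_eq' by (rule group.mono_derived[OF group_FG]) (auto simp: FK_def)

lemma DK_subset_FK: "DK \<subseteq> FK"
  unfolding DK_eq' by (rule group.derived_incl[OF group_FG _ subgroup_FK]) simp

lemma commutator_DG:
  assumes "\<alpha> \<in> FG" "\<beta> \<in> FG"
  shows "\<alpha> \<circ> \<beta> \<circ> inv_into UNIV \<alpha> \<circ> inv_into UNIV \<beta> \<in> DG"
  unfolding DG_eq derived_def
  by (rule generate.incl, rule UN_I[OF assms(1)], rule UN_I[OF assms(2)])
     (simp only: singleton_iff monoid.simps fun_group_inv[OF group_FG assms(1) FG_bij[OF assms(1)]]
        fun_group_inv[OF group_FG assms(2) FG_bij[OF assms(2)]])

lemma commutator_DK: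
  assumes "\<alpha> \<in> FK" "\<beta> \<in> FK"
  shows "\<alpha> \<circ> \<beta> \<circ> inv_into UNIV \<alpha> \<circ> inv_into UNIV \<beta> \<in> DK"
proof -
  have G: "\<alpha> \<in> FG" "\<beta> \<in> FG" using assms by (auto simp: FK_def)
  show ?thesis unfolding DK_eq' derived_def
  by (rule generate.incl, rule UN_I[OF assms(1)], rule UN_I[OF assms(2)])
     (simp only: singleton_iff monoid.simps fun_group_inv[OF group_FG G(1) FG_bij[OF G(1)]]
        fun_group_inv[OF group_FG G(2) FG_bij[OF G(2)]])
qed

lemma DG_induct:
  assumes "\<alpha> \<in> DG"
    and comm: "\<And>\<alpha> \<beta>. \<alpha> \<in> FG \<Longrightarrow> \<beta> \<in> FG \<Longrightarrow> Q (\<alpha> \<circ> \<beta> \<circ> inv_into UNIV \<alpha> \<circ> inv_into UNIV \<beta>)"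
    and id: "Q id"
    and comp: "\<And>\<alpha> \<beta>. \<alpha> \<in> FG \<Longrightarrow> \<beta> \<in> FG \<Longrightarrow> Q \<alpha> \<Longrightarrow> Q \<beta> \<Longrightarrow> Q (\<alpha> \<circ> \<beta>)"
    and inv: "\<And>\<alpha>. \<alpha> \<in> FG \<Longrightarrow> Q \<alpha> \<Longrightarrow> Q (inv_into UNIV \<alpha>)"
  shows "Q \<alpha>"
proof -
  interpret group "fun_group FG" by (rule group_FG)
  have sub: "\<alpha> \<in> FG" if "\<alpha> \<in> generate (fun_group FG) (derived_set (fun_group FG) FG)" for \<alpha>
    using that subgroup.subset[OF subgroup_DG] unfolding DG_eq derived_def by auto
  have c: "Q \<alpha>" if "\<alpha> \<in> derived_set (fun_group FG) FG" for \<alpha>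
    using that comm fun_group_inv[OF group_FG _ FG_bij] by auto
  have "\<alpha> \<in> generate (fun_group FG) (derived_set (fun_group FG) FG)"
    using assms(1) unfolding DG_eq derived_def .
  thus ?thesis
  proof (induction rule: generate.induct)
    case one show ?case using id by (simp only: monoid.simps)
  next
    case (incl h) thus ?case using c by blast
  next
    case (inv h)
    have hF: "h \<in> FG" using sub[OF generate.incl[OF inv]] .
    show ?case unfolding fun_group_inv[OF group_FG hF FG_bij[OF hF]] by (rule assms(5)[OF hF c[OF inv]])
  next
    case (eng h1 h2)
    have "Q (h1 \<circ> h2)" by (rule comp[OF sub[OF eng.hyps(1)] sub[OF eng.hyps(2)] eng.IH])
    thus ?case by (simp only: monoid.simps)
  qed
qed

lemma DG_ind:
  assumes "\<alpha> \<in> DG" shows "ind \<alpha> = 0"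
  using assms
proof (rule DG_induct)
  fix \<alpha> \<beta> assume "\<alpha> \<in> FG" "\<beta> \<in> FG"
  thus "ind (\<alpha> \<circ> \<beta> \<circ> inv_into UNIV \<alpha> \<circ> inv_into UNIV \<beta>) = 0"
    by (simp only: ind_comp ind_inv comp_FG inv_FG)
qed (simp_all only: ind_id ind_comp ind_inv add_0 minus_zero)

section \<open>Local transpositions\<close>

text \<open>With \<open>q = P n p\<close>, the map \<open>s\<close> exchanges a small clopen
  neighbourhood \<open>V\<close> of \<open>p\<close> with its translate by \<open>P n\<close>. A
  point changes sides under a step by \<open>n\<close> only if it is some \<open>P k x\<close> with
  \<open>\<bar>k\<bar> \<le> \<bar>n\<bar>\<close>, so if \<open>V\<close> avoids all of these
  except \<open>p\<close>, then \<open>s\<close> can cross the cut only at \<open>p\<close> and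
  \<open>q\<close>.\<close>

lemma swap_exists:
  assumes p: "p \<in> orbit" and q: "q \<in> orbit" and pq: "p \<noteq> q" and T: "finite T" "p \<notin> T" "q \<notin> T"
  shows "\<exists>s\<in>FG. s p = q \<and> s q = p \<and> (\<forall>t\<in>T. s t = t) \<and>
    (\<forall>z. z \<noteq> p \<and> z \<noteq> q \<longrightarrow> (s z \<in> A \<longleftrightarrow> z \<in> A)) \<and> (\<forall>z. s (s z) = z)"
proof -
  obtain i j where ij: "p = P i x" "q = P j x" using p q unfolding orbit_def by auto
  define n where "n = j - i"
  have qn: "q = P n p" unfolding ij n_def by (simp add: P_add)
  \<comment> \<open>\<open>T\<close> and its translate are kept out of \<open>V\<close>, so that
    neither half of the exchange touches \<open>T\<close>; the third part holds the other points
    that a step by \<open>n\<close> can carry across the cut.\<close>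
  define Bad where "Bad = T \<union> (\<lambda>t. P (- n) t) ` T \<union> ((\<lambda>k. P k x) ` {- \<bar>n\<bar>..\<bar>n\<bar>} - {p})"
  have fb: "finite Bad" unfolding Bad_def using T by auto
  have "p \<notin> (\<lambda>t. P (- n) t) ` T" using T(3) qn by (auto simp: P_add)
  hence pb: "p \<notin> Bad" unfolding Bad_def using T by blast
  obtain W1 W2 where W: "open W1" "open W2" "p \<in> W1" "q \<in> W2" "W1 \<inter> W2 = {}"
    using hausdorff[OF pq] by blast
  have "open ((W1 \<inter> {z. P n z \<in> W2}) - Bad)"
    by (intro open_Diff open_Int W(1) open_P[OF W(2)] finite_imp_closed[OF fb])
  moreover have "p \<in> (W1 \<inter> {z. P n z \<in> W2}) - Bad" using W pb qn by auto
  ultimately obtain V where V: "open V" "closed V" "p \<in> V" "V \<subseteq> (W1 \<inter> {z. P n z \<in> W2}) - Bad"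
    using clopen_basis by metis
  have disj: "P n z \<notin> V" if "z \<in> V" for z using that V(4) W(5) by auto
  define V' where "V' = {z. P (- n) z \<in> V}"
  have V': "open V'" "closed V'" unfolding V'_def using open_P closed_P V by auto
  have inV': "P n z \<in> V' \<longleftrightarrow> z \<in> V" for z unfolding V'_def by (simp add: P_add)
  have VV': "z \<notin> V'" if "z \<in> V" for z using disj[of "P (- n) z"] that unfolding V'_def by (auto simp: P_add)
  define c where "c = (\<lambda>z. if z \<in> V then n else if z \<in> V' then - n else 0)"
  define s where "s = (\<lambda>z. P (c z) z)"
  have s1: "s z = P n z" if "z \<in> V" for z using that by (simp add: s_def c_def)
  have s2: "s z = P (- n) z" if "z \<in> V'" for z using that VV' by (auto simp: s_def c_def)
  have s3: "s z = z" if "z \<notin> V" "z \<notin> V'" for z using that by (simp add: s_def c_def)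
  have ss: "s (s z) = z" for z
  proof -
    consider "z \<in> V" | "z \<in> V'" | "z \<notin> V" "z \<notin> V'" by blast
    thus ?thesis
    proof cases
      case 1 thus ?thesis using inV'[of z] by (simp add: s1 s2 P_add)
    next
      case 2 
      hence "P (- n) z \<in> V" by (simp add: V'_def)
      thus ?thesis using 2 by (simp add: s1 s2 P_add)
    next
      case 3 thus ?thesis by (simp add: s3)
    qed
  qed
  have cc: "continuous_on UNIV c" unfolding c_def
    by (intro continuous_int_if V V' continuous_on_const)
  have sF: "s \<in> FG" by (rule FGI[OF _ _ cc]) (use bij_involution[OF ss] s_def in auto)
  have Vp: "z = p" if z: "z \<in> V" and "(z \<in> A) \<noteq> (P n z \<in> A)" for z
  proof -
    have "z \<in> orbit" using that A_subset_orbit by (metis P_in_orbit subsetD)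
    then obtain k where k: "z = P k x" unfolding orbit_def by auto
    have "(k \<ge> 1) \<noteq> (n + k \<ge> 1)" using that(2) unfolding k by (simp add: P_add)
    hence "k \<in> {- \<bar>n\<bar>..\<bar>n\<bar>}" by auto
    moreover have "z \<notin> Bad" using V(4) z by auto
    ultimately show "z = p" unfolding Bad_def k by blast
  qed
  have "s z \<in> A \<longleftrightarrow> z \<in> A" if "z \<noteq> p" "z \<noteq> q" for z
  proof -
    consider "z \<in> V" | "z \<in> V'" | "z \<notin> V" "z \<notin> V'" by blast
    thus ?thesis
    proof cases
      case 1 thus ?thesis using Vp[of z] that s1 by auto
    next
      case 2
      have "P (- n) z \<in> V" "P (- n) z \<noteq> p" "P n (P (- n) z) = z"
        using 2 that qn by (auto simp: V'_def P_add)
      thus ?thesis using Vp[of "P (- n) z"] s2[OF 2] by auto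
    next
      case 3 thus ?thesis by (simp add: s3)
    qed
  qed
  moreover have "s t = t" if "t \<in> T" for t
  proof (rule s3)
    show "t \<notin> V" using V(4) that by (auto simp: Bad_def)
    have "P (- n) t \<in> Bad" using that by (auto simp: Bad_def)
    thus "t \<notin> V'" using V(4) by (auto simp: V'_def)
  qed
  moreover have "s p = q" using s1[OF V(3)] qn by simp
  moreover from this have "s q = p" using ss by metis
  ultimately show ?thesis using sF ss by blast
qed

lemma swap_FK:
  assumes "p \<in> A \<and> q \<in> A \<or> p \<in> orbit - A \<and> q \<in> orbit - A" and "p \<noteq> q" "finite T" "p \<notin> T" "q \<notin> T"
  shows "\<exists>s\<in>FK. s p = q \<and> s q = p \<and> (\<forall>t\<in>T. s t = t) \<and> (\<forall>z. s (s z) = z)"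
proof -
  have "p \<in> orbit" "q \<in> orbit" using assms A_subset_orbit by auto
  from swap_exists[OF this assms(2-)] obtain s where s: "s \<in> FG" "s p = q" "s q = p" "\<forall>t\<in>T. s t = t"
    "\<forall>z. z \<noteq> p \<and> z \<noteq> q \<longrightarrow> (s z \<in> A \<longleftrightarrow> z \<in> A)" "\<forall>z. s (s z) = z" by blast
  have "s z \<in> A \<longleftrightarrow> z \<in> A" for z using s(2,3,5) assms(1) by (cases "z = p"; cases "z = q") auto
  hence "s \<in> FK" using s(1) FK_iff by blast
  thus ?thesis using s by blast
qed

lemma infinite_orbit_minus_A: "infinite (orbit - A)"
proof -
  have "(\<lambda>n. P n x) ` {..0} \<subseteq> orbit - A" unfolding orbit_def by auto
  moreover have "infinite ((\<lambda>n. P n x) ` {..0::int})"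
    using infinite_Iic by (subst finite_image_iff) (auto intro: inj_onI)
  ultimately show ?thesis using finite_subset by blast
qed

text \<open>Two involutions exchanging \<open>p\<close> with \<open>r\<close> and \<open>r\<close>
  with \<open>q\<close>, for a spare point \<open>r\<close> on the same side, have a commutator that
  sends \<open>p\<close> to \<open>q\<close>. As involutions are their own inverses, it is
  \<open>a \<circ> b \<circ> a \<circ> b\<close>.\<close>

lemma DK_move:
  assumes side: "p \<in> A \<and> q \<in> A \<or> p \<in> orbit - A \<and> q \<in> orbit - A" and pq: "p \<noteq> q" and T: "finite T" "p \<notin> T" "q \<notin> T"
  shows "\<exists>k\<in>DK. k p = q \<and> (\<forall>t\<in>T. k t = t)"
proof -
  define B where "B = (if p \<in> A then A else orbit - A)"
  have B: "p \<in> B" "q \<in> B" "infinite B" using side infinite_A infinite_orbit_minus_A by (auto simp: B_def)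
  have "infinite (B - (T \<union> {p, q}))" using B(3) T(1) by (simp add: Diff_infinite_finite)
  then obtain r where r: "r \<in> B" "r \<notin> T" "r \<noteq> p" "r \<noteq> q" by (metis DiffD1 DiffD2 UnCI ex_in_conv finite.emptyI insertCI)
  have "p \<in> A \<and> r \<in> A \<or> p \<in> orbit - A \<and> r \<in> orbit - A" "r \<in> A \<and> q \<in> A \<or> r \<in> orbit - A \<and> q \<in> orbit - A"
    using side r(1) by (auto simp: B_def split: if_splits)
  with swap_FK[of p r "insert q T"] swap_FK[of r q "insert p T"] r pq T
  obtain a b where a: "a \<in> FK" "a p = r" "a r = p" "\<forall>t\<in>insert q T. a t = t" "\<And>z. a (a z) = z"
    and b: "b \<in> FK" "b r = q" "b q = r" "\<forall>t\<in>insert p T. b t = t" "\<And>z. b (b z) = z" by auto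
  have "a \<circ> b \<circ> a \<circ> b \<in> DK"
    using commutator_DK[OF a(1) b(1)] bij_involution[of a] bij_involution[of b] a b by simp
  moreover have "(a \<circ> b \<circ> a \<circ> b) p = q" using a b by simp
  moreover have "\<forall>t\<in>T. (a \<circ> b \<circ> a \<circ> b) t = t" using a b by simp
  ultimately show ?thesis by blast
qed

text \<open>The commutator of an exchange of \<open>p\<close> and \<open>r\<close> inside
  \<open>A\<close> with an exchange of \<open>p\<close> and \<open>q\<close> across the cut sends
  \<open>p\<close> to \<open>r\<close>, \<open>r\<close> to \<open>q\<close> and \<open>q\<close> to
  \<open>p\<close>. On \<open>A\<close> as a set, this trades \<open>p\<close> for
  \<open>q\<close>.\<close>

lemma DG_exchange:
  assumes p: "p \<in> A" and q: "q \<in> orbit - A"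
  shows "\<exists>k\<in>DG. k ` A = insert q (A - {p})"
proof -
  have "infinite (A - {p})" using infinite_A by simp
  then obtain r where r: "r \<in> A" "r \<noteq> p" by (metis DiffD1 DiffD2 ex_in_conv finite.emptyI insertCI)
  have ne: "p \<noteq> q" "r \<noteq> q" "p \<in> orbit" using p q r A_subset_orbit by auto
  have "\<exists>s\<in>FK. s r = p \<and> s p = r \<and> (\<forall>t\<in>{q}. s t = t) \<and> (\<forall>z. s (s z) = z)"
    by (rule swap_FK) (use p r ne in auto)
  then obtain a where a: "a \<in> FK" "a r = p" "a p = r" "a q = q" "\<And>z. a (a z) = z" by auto
  have "\<exists>s\<in>FG. s p = q \<and> s q = p \<and> (\<forall>t\<in>{r}. s t = t) \<and>
    (\<forall>z. z \<noteq> p \<and> z \<noteq> q \<longrightarrow> (s z \<in> A \<longleftrightarrow> z \<in> A)) \<and> (\<forall>z. s (s z) = z)"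
    by (rule swap_exists) (use p q r ne in auto)
  then obtain b where b: "b \<in> FG" "b p = q" "b q = p" "b r = r" "\<And>z. z \<noteq> p \<Longrightarrow> z \<noteq> q \<Longrightarrow> b z \<in> A \<longleftrightarrow> z \<in> A"
    "\<And>z. b (b z) = z" by auto
  have aG: "a \<in> FG" and aA: "a z \<in> A \<longleftrightarrow> z \<in> A" for z using a(1) FK_iff by auto
  define k where "k = a \<circ> b \<circ> a \<circ> b"
  have kD: "k \<in> DG" unfolding k_def
    using commutator_DG[OF aG b(1)] bij_involution[of a] bij_involution[of b] a(5) b(6) by simp
  \<comment> \<open>\<open>l\<close> is the inverse of \<open>k\<close>, so membership in the image
    of \<open>A\<close> under \<open>k\<close> is tested by following \<open>l\<close>. A point
    other than \<open>p\<close>, \<open>q\<close>, \<open>r\<close> never reaches these three along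
    the way, and so never changes sides.\<close>
  define l where "l = (\<lambda>y. b (a (b (a y))))"
  have kl: "k (l y) = y" "l (k y) = y" for y unfolding k_def l_def using a(5) b(6) by auto
  have l: "l y \<in> A \<longleftrightarrow> y \<in> insert q (A - {p})" for y
  proof -
    consider "y = p" | "y = q" | "y = r" | "y \<noteq> p" "y \<noteq> q" "y \<noteq> r" by blast
    thus ?thesis
    proof cases
      case 4
      have "a y \<noteq> p" "a y \<noteq> q" "a y \<noteq> r" using 4 a by metis+
      moreover from this have "b (a y) \<noteq> p" "b (a y) \<noteq> q" "b (a y) \<noteq> r" using b by metis+
      moreover from this have "a (b (a y)) \<noteq> p" "a (b (a y)) \<noteq> q" "a (b (a y)) \<noteq> r" using a by metis+
      ultimately show ?thesis using 4 b(5) aA by (simp add: l_def)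
    qed (use a b p q r in \<open>auto simp: l_def\<close>)
  qed
  have "y \<in> k ` A \<longleftrightarrow> l y \<in> A" for y using kl by (metis imageE imageI)
  hence "k ` A = insert q (A - {p})" using l by blast
  thus ?thesis using kD by blast
qed

text \<open>All the moves and exchanges required lie in \<open>DG\<close>, so one argument serves
  every group between \<open>DG\<close> and the kernel of \<open>ind\<close>, in particular the two
  groups of the theorem.\<close>

lemma maximal_in_stabilizer:
  assumes sub: "subgroup \<Gamma> (fun_group FG)" and D: "DG \<subseteq> \<Gamma>" and ind: "\<And>g. g \<in> \<Gamma> \<Longrightarrow> ind g = 0"
  shows "maximal_subgroup (\<Gamma> \<inter> FK) (fun_group \<Gamma>)"
proof -
  have GF: "\<Gamma> \<subseteq> FG" using subgroup.subset[OF sub] by simp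
  have eq: "\<Gamma> \<inter> FK = {g \<in> \<Gamma>. g ` A = A}" using GF by (auto simp: FK_def)
  show ?thesis unfolding eq
  proof (rule maximal_stabilizer[where Ob = orbit])
    show "group (fun_group \<Gamma>)" using group.subgroup_imp_group[OF group_FG sub] by simp
    show "bij g" if "g \<in> \<Gamma>" for g using that GF FG_bij by blast
    show "infinite A" by (rule infinite_A)
    show "orbit - A \<noteq> {}" using infinite_orbit_minus_A by (metis finite.emptyI)
    show "finite (A - g ` A) \<and> finite (g ` A - A) \<and> card (A - g ` A) = card (g ` A - A)" if "g \<in> \<Gamma>" for g
      using FG_commensurate[of g] ind[OF that] that GF unfolding commensurate_def ind_def excess_eq_0_iff by auto
    show "g ` A \<subseteq> orbit" if "g \<in> \<Gamma>" for g
      using that GF FG_orbit[of g] A_subset_orbit by blast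
  next
    fix p q and T :: "'a set"
    assume a: "finite T" "p \<noteq> q" "p \<notin> T" "q \<notin> T" "p \<in> A \<and> q \<in> A \<or> p \<in> orbit - A \<and> q \<in> orbit - A"
    obtain k where k: "k \<in> DK" "k p = q" "\<forall>t\<in>T. k t = t" using DK_move[OF a(5,2,1,3,4)] by blast
    have "k \<in> \<Gamma>" using k(1) DK_subset_DG D by blast
    moreover have "k \<in> FK" using k(1) DK_subset_FK by blast
    hence "k ` A = A" by (simp add: FK_def)
    ultimately show "\<exists>k\<in>\<Gamma>. k ` A = A \<and> k p = q \<and> (\<forall>t\<in>T. k t = t)" using k by blast
  next
    fix p q assume "p \<in> A" "q \<in> orbit - A"
    thus "\<exists>k\<in>\<Gamma>. k ` A = insert q (A - {p})" using DG_exchange D by blast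
  qed
qed

section \<open>The kernel of the index map\<close>

text \<open>\<open>slice a n\<close> is the chain \<open>a\<close> on \<open>X \<times> {n}\<close>, and \<open>tri a n m\<close> is the boundary of the 2-chain that carries \<open>a\<close>
  on the pairs \<open>((y, n), (P (- n) y, m))\<close>.\<close>

definition slice :: "('a \<Rightarrow> int) \<Rightarrow> int \<Rightarrow> 'a \<times> int \<Rightarrow> int" where
  "slice a n = (\<lambda>(y, k). if k = n then a y else 0)"

definition tri :: "('a \<Rightarrow> int) \<Rightarrow> int \<Rightarrow> int \<Rightarrow> 'a \<times> int \<Rightarrow> int" where
  "tri a n m w = slice (\<lambda>y. a (P n y)) m w - slice a (n + m) w + slice a n w"

abbreviation box :: "nat \<Rightarrow> int set" where "box N \<equiv> {- int N..int N}"

abbreviation Bd :: "('a \<times> int \<Rightarrow> int) set" where "Bd \<equiv> boundary_group G"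

text \<open>A composable pair is determined by the range \<open>y\<close> of its first arrow and the
  two integers. This splits a 2-chain with bounded integers into finitely many functions of
  \<open>y\<close>, and turns each fibre sum into a sum over one integer.\<close>

lemma boundary2_eq:
  fixes f :: "('a \<times> int) \<times> ('a \<times> int) \<Rightarrow> int"
  assumes supp: "\<And>y n z m. f ((y, n), (z, m)) \<noteq> 0 \<Longrightarrow> z = P (- n) y \<and> n \<in> box N \<and> m \<in> box N"
  shows "boundary2 G f w = (\<Sum>n\<in>box N. \<Sum>m\<in>box N. tri (\<lambda>y. f ((y, n), (P (- n) y, m))) n m w)"
proof -
  obtain z k where w: "w = (z, k)" by (cases w)
  have z0: "f ((y, n), (P (- n) y, m)) = 0" if "n \<notin> box N \<or> m \<notin> box N" for y n m
    using supp that by blast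
  have "pushforward (\<lambda>(g, h). h) f (z, k) = (\<Sum>n\<in>box N. f ((P n z, n), (z, k)))"
    by (rule pushforward_eq_sum) (use supp in \<open>auto intro!: inj_onI simp: P_add image_iff split: prod.splits\<close>, force simp: P_add)
  also have "\<dots> = (\<Sum>n\<in>box N. \<Sum>m\<in>box N. slice (\<lambda>y. f ((P n y, n), (P (- n) (P n y), m))) m (z, k))"
  proof (intro sum.cong refl)
    fix n assume "n \<in> box N"
    show "f ((P n z, n), (z, k)) = (\<Sum>m\<in>box N. slice (\<lambda>y. f ((P n y, n), (P (- n) (P n y), m))) m (z, k))"
      using z0[of n k "P n z"] by (auto simp: slice_def P_add sum.delta)
  qed
  finally have 1: "pushforward (\<lambda>(g, h). h) f (z, k) = \<dots>" .
  have "pushforward (\<lambda>(g, h). prd G g h) f (z, k) = (\<Sum>n\<in>box N. f ((z, n), (P (- n) z, k - n)))"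
    by (rule pushforward_eq_sum) (use supp in \<open>auto intro!: inj_onI simp: transformation_groupoid_def image_iff split: prod.splits\<close>)
  also have "\<dots> = (\<Sum>n\<in>box N. \<Sum>m\<in>box N. slice (\<lambda>y. f ((y, n), (P (- n) y, m))) (n + m) (z, k))"
  proof (intro sum.cong refl)
    fix n assume "n \<in> box N"
    have "(\<Sum>m\<in>box N. slice (\<lambda>y. f ((y, n), (P (- n) y, m))) (n + m) (z, k))
      = (\<Sum>m\<in>box N. if m = k - n then f ((z, n), (P (- n) z, m)) else 0)"
      by (intro sum.cong refl) (auto simp: slice_def)
    thus "f ((z, n), (P (- n) z, k - n)) = (\<Sum>m\<in>box N. slice (\<lambda>y. f ((y, n), (P (- n) y, m))) (n + m) (z, k))"
      using z0[of n "k - n" z] by (auto simp: sum.delta)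
  qed
  finally have 2: "pushforward (\<lambda>(g, h). prd G g h) f (z, k) = \<dots>" .
  have "pushforward (\<lambda>(g, h). g) f (z, k) = (\<Sum>m\<in>box N. f ((z, k), (P (- k) z, m)))"
    by (rule pushforward_eq_sum) (use supp in \<open>auto intro!: inj_onI simp: image_iff split: prod.splits\<close>)
  also have "\<dots> = (\<Sum>m\<in>box N. \<Sum>n\<in>box N. slice (\<lambda>y. f ((y, n), (P (- n) y, m))) n (z, k))"
  proof (intro sum.cong refl)
    fix m assume "m \<in> box N"
    show "f ((z, k), (P (- k) z, m)) = (\<Sum>n\<in>box N. slice (\<lambda>y. f ((y, n), (P (- n) y, m))) n (z, k))"
      using z0[of k m z] by (auto simp: slice_def sum.delta)
  qed
  also have "\<dots> = (\<Sum>n\<in>box N. \<Sum>m\<in>box N. slice (\<lambda>y. f ((y, n), (P (- n) y, m))) n (z, k))"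
    by (rule sum.swap)
  finally have 3: "pushforward (\<lambda>(g, h). g) f (z, k) = \<dots>" .
  show ?thesis unfolding w boundary2_def 1 2 3 tri_def by (simp add: sum.distrib sum_subtractf)
qed

text \<open>The integer coordinates are continuous on the compact set that carries the chain, hence
  bounded; this gives the box.\<close>

lemma boundary_groupE:
  assumes "b \<in> Bd"
  obtains N a where "\<And>n m. continuous_on UNIV (a n m)" "b = (\<lambda>w. \<Sum>n\<in>box N. \<Sum>m\<in>box N. tri (a n m) n m w)"
proof -
  obtain f where f: "f \<in> Cc (composable_pairs G)" "b = boundary2 G f"
    using assms unfolding boundary_group_def by auto
  then obtain C where C: "compact C" "C \<subseteq> composable_pairs G" "\<And>z. z \<notin> C \<Longrightarrow> f z = 0"
    and cf: "continuous_on (composable_pairs G) f" unfolding Cc_def by auto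
  have "continuous_on C (\<lambda>v. snd (fst v))" "continuous_on C (\<lambda>v. snd (snd v))"
    by (intro continuous_intros)+
  from compact_int_image_bounded[OF C(1) this(1)] compact_int_image_bounded[OF C(1) this(2)]
  obtain N1 N2 where N: "(\<lambda>v. snd (fst v)) ` C \<subseteq> box N1" "(\<lambda>v. snd (snd v)) ` C \<subseteq> box N2" by blast
  define N where "N = max N1 N2"
  have sup: "z = P (- n) y \<and> n \<in> box N \<and> m \<in> box N" if "f ((y, n), (z, m)) \<noteq> 0" for y n z m
  proof -
    have c: "((y, n), (z, m)) \<in> C" using C(3) that by blast
    have "n \<in> box N1" "m \<in> box N2" using N c by force+
    moreover have "z = P (- n) y" using C(2) c by (auto simp: composable_pairs_def transformation_groupoid_def)
    ultimately show ?thesis by (auto simp: N_def)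
  qed
  have "continuous_on UNIV (\<lambda>y. f ((y, n), (P (- n) y, m)))" for n m
  proof (rule continuous_on_compose2[OF cf])
    show "continuous_on UNIV (\<lambda>y. ((y, n), P (- n) y, m))"
      by (intro continuous_on_Pair continuous_on_id continuous_on_const P_continuous)
  qed (auto simp: composable_pairs_def transformation_groupoid_def)
  moreover have "b = (\<lambda>w. \<Sum>n\<in>box N. \<Sum>m\<in>box N. tri (\<lambda>y. f ((y, n), (P (- n) y, m))) n m w)"
    unfolding f(2) by (rule ext, rule boundary2_eq) (use sup in blast)
  ultimately show thesis by (rule that)
qed

lemma boundary_groupI:
  assumes a: "\<And>n m. continuous_on UNIV (a n m)"
  shows "(\<lambda>w. \<Sum>n\<in>box N. \<Sum>m\<in>box N. tri (a n m) n m w) \<in> Bd"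
proof -
  define f where "f = (\<lambda>((y, n), (z, m)). if z = P (- n) y \<and> n \<in> box N \<and> m \<in> box N then a n m y else 0)"
  have ev: "boundary2 G f = (\<lambda>w. \<Sum>n\<in>box N. \<Sum>m\<in>box N. tri (a n m) n m w)"
  proof
    fix w
    have "boundary2 G f w = (\<Sum>n\<in>box N. \<Sum>m\<in>box N. tri (\<lambda>y. f ((y, n), (P (- n) y, m))) n m w)"
      by (rule boundary2_eq) (auto simp: f_def split: if_splits)
    thus "boundary2 G f w = (\<Sum>n\<in>box N. \<Sum>m\<in>box N. tri (a n m) n m w)" by (simp add: f_def)
  qed
  define C where "C = (\<lambda>(y, n, m). ((y, n), (P (- n) y, m))) ` ((UNIV :: 'a set) \<times> box N \<times> box N)"
  have "compact C" unfolding C_def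
  proof (rule compact_continuous_image)
    have "continuous_on UNIV (\<lambda>v::'a \<times> int \<times> int. (\<lambda>(y, n). P (- n) y) (fst v, fst (snd v)))"
      by (rule continuous_on_compose2[OF continuous_src]) (intro continuous_intros, simp)
    hence "continuous_on UNIV (\<lambda>v::'a \<times> int \<times> int. ((fst v, fst (snd v)), (P (- fst (snd v)) (fst v), snd (snd v))))"
      by (intro continuous_on_Pair continuous_intros) auto
    thus "continuous_on (UNIV \<times> box N \<times> box N) (\<lambda>(y, n, m). ((y, n), (P (- n) y, m)))"
      by (auto simp: case_prod_unfold intro: continuous_on_subset)
    show "compact ((UNIV :: 'a set) \<times> box N \<times> box N)"
      by (intro compact_Times compact_UNIV finite_imp_compact) auto
  qed
  moreover have "C \<subseteq> composable_pairs G"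
    by (auto simp: C_def composable_pairs_def transformation_groupoid_def)
  moreover have "f z = 0" if "z \<notin> C" for z
    using that by (force simp: f_def C_def image_iff split: prod.splits if_splits)
  moreover have "continuous_on (composable_pairs G) f"
  proof -
    \<comment> \<open>On composable pairs the test on \<open>z\<close> in \<open>f\<close> holds, so
      \<open>f\<close> agrees there with the function \<open>h\<close> below, which ignores
      \<open>z\<close> and is continuous on the whole product.\<close>
    define e where "e = (\<lambda>n m. if n \<in> box N \<and> m \<in> box N then a n m else (\<lambda>_. 0))"
    have e: "continuous_on UNIV (e n m)" for n m using a by (simp add: e_def)
    define h where "h = (\<lambda>((y, n), (z :: 'a, m)). e n m y)"
    have "open (h -` S)" for S
    proof -
      have "h -` S = (\<Union>n m. ({y. e n m y \<in> S} \<times> {n}) \<times> (UNIV \<times> {m}))"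
        by (auto simp: h_def)
      also have "open \<dots>"
        by (intro open_UN open_Times ballI continuous_int_open[OF e] open_discrete open_UNIV)
      finally show ?thesis .
    qed
    hence "continuous_on UNIV h" by (simp add: continuous_on_open_vimage)
    hence "continuous_on (composable_pairs G) h" by (rule continuous_on_subset) simp
    thus ?thesis
      by (rule continuous_on_eq) (auto simp: h_def e_def f_def composable_pairs_def transformation_groupoid_def)
  qed
  ultimately have "f \<in> Cc (composable_pairs G)" unfolding Cc_def by blast
  thus ?thesis unfolding boundary_group_def ev[symmetric] by blast
qed

lemma tri_zero: "tri (\<lambda>_. 0) n m w = 0"
  by (auto simp: tri_def slice_def split: prod.splits)

lemma tri_add: "tri (\<lambda>y. a y + b y) n m w = tri a n m w + tri b n m w"
  by (auto simp: tri_def slice_def split: prod.splits)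

lemma tri_minus: "tri (\<lambda>y. - a y) n m w = - tri a n m w"
  by (auto simp: tri_def slice_def split: prod.splits)

text \<open>Padding with zero coefficients brings two boundaries to a common box, so that they can
  be added termwise.\<close>

lemma boundary_extend:
  assumes "N \<le> M"
  shows "(\<Sum>n\<in>box N. \<Sum>m\<in>box N. tri (a n m) n m w)
    = (\<Sum>n\<in>box M. \<Sum>m\<in>box M. tri (if n \<in> box N \<and> m \<in> box N then a n m else (\<lambda>_. 0)) n m w)"
proof -
  have sub: "box N \<subseteq> box M" using assms by auto
  have "(\<Sum>n\<in>box N. \<Sum>m\<in>box N. tri (a n m) n m w)
     = (\<Sum>n\<in>box N. \<Sum>m\<in>box M. tri (if n \<in> box N \<and> m \<in> box N then a n m else (\<lambda>_. 0)) n m w)"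
    by (intro sum.cong refl sum.mono_neutral_cong_left) (use sub in \<open>auto simp: tri_zero\<close>)
  also have "\<dots> = (\<Sum>n\<in>box M. \<Sum>m\<in>box M. tri (if n \<in> box N \<and> m \<in> box N then a n m else (\<lambda>_. 0)) n m w)"
    by (intro sum.mono_neutral_left) (use sub in \<open>auto simp: tri_zero intro!: sum.neutral\<close>)
  finally show ?thesis .
qed

lemma Bd_add:
  assumes "b \<in> Bd" "c \<in> Bd" shows "(\<lambda>w. b w + c w) \<in> Bd"
proof -
  obtain N a where a: "\<And>n m. continuous_on UNIV (a n m)" "b = (\<lambda>w. \<Sum>n\<in>box N. \<Sum>m\<in>box N. tri (a n m) n m w)"
    using boundary_groupE[OF assms(1)] by blast
  obtain N' a' where a': "\<And>n m. continuous_on UNIV (a' n m)" "c = (\<lambda>w. \<Sum>n\<in>box N'. \<Sum>m\<in>box N'. tri (a' n m) n m w)"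
    using boundary_groupE[OF assms(2)] by blast
  define M where "M = max N N'"
  define e where "e = (\<lambda>n m. if n \<in> box N \<and> m \<in> box N then a n m else (\<lambda>_. 0))"
  define e' where "e' = (\<lambda>n m. if n \<in> box N' \<and> m \<in> box N' then a' n m else (\<lambda>_. 0))"
  have c: "continuous_on UNIV (e n m)" "continuous_on UNIV (e' n m)" for n m
    using a(1) a'(1) by (auto simp: e_def e'_def)
  have "b = (\<lambda>w. \<Sum>n\<in>box M. \<Sum>m\<in>box M. tri (e n m) n m w)" unfolding a(2) e_def
    by (rule ext, rule boundary_extend) (simp add: M_def)
  moreover have "c = (\<lambda>w. \<Sum>n\<in>box M. \<Sum>m\<in>box M. tri (e' n m) n m w)" unfolding a'(2) e'_def
    by (rule ext, rule boundary_extend) (simp add: M_def)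
  ultimately have "(\<lambda>w. b w + c w) = (\<lambda>w. \<Sum>n\<in>box M. \<Sum>m\<in>box M. tri (\<lambda>y. e n m y + e' n m y) n m w)"
    by (simp add: tri_add sum.distrib)
  also have "\<dots> \<in> Bd" by (rule boundary_groupI) (intro continuous_on_add c)
  finally show ?thesis .
qed

lemma Bd_minus:
  assumes "b \<in> Bd" shows "(\<lambda>w. - b w) \<in> Bd"
proof -
  obtain N a where a: "\<And>n m. continuous_on UNIV (a n m)" "b = (\<lambda>w. \<Sum>n\<in>box N. \<Sum>m\<in>box N. tri (a n m) n m w)"
    using boundary_groupE[OF assms] by blast
  have "(\<lambda>w. - b w) = (\<lambda>w. \<Sum>n\<in>box N. \<Sum>m\<in>box N. tri (\<lambda>y. - a n m y) n m w)"
    unfolding a(2) by (simp add: tri_minus sum_negf)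
  also have "\<dots> \<in> Bd" by (rule boundary_groupI) (rule continuous_int_map[OF a(1)])
  finally show ?thesis .
qed

lemma Bd_diff: "b \<in> Bd \<Longrightarrow> c \<in> Bd \<Longrightarrow> (\<lambda>w. b w - c w) \<in> Bd"
  using Bd_add[OF _ Bd_minus, of b c] by simp

lemma Bd_zero: "(\<lambda>_. 0) \<in> Bd"
  using boundary_groupI[of "\<lambda>_ _ _. 0" 0] by (simp add: tri_zero)

lemma Bd_sum:
  assumes "finite I" "\<And>i. i \<in> I \<Longrightarrow> b i \<in> Bd" shows "(\<lambda>w. \<Sum>i\<in>I. b i w) \<in> Bd"
  using assms by (induction I rule: finite_induct) (auto simp: Bd_zero Bd_add)

lemma tri_Bd:
  assumes "continuous_on UNIV a" shows "tri a n m \<in> Bd"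
proof -
  define N where "N = nat (\<bar>n\<bar> + \<bar>m\<bar>)"
  define b where "b = (\<lambda>n' m'. if n' = n \<and> m' = m then a else (\<lambda>_. 0))"
  have N: "n \<in> box N" "m \<in> box N" by (auto simp: N_def)
  have "(\<Sum>n'\<in>box N. \<Sum>m'\<in>box N. tri (b n' m') n' m' w) = tri a n m w" for w
  proof -
    have "(\<Sum>n'\<in>box N. \<Sum>m'\<in>box N. tri (b n' m') n' m' w)
      = (\<Sum>n'\<in>box N. \<Sum>m'\<in>box N. if m' = m then (if n' = n then tri a n m w else 0) else 0)"
      by (intro sum.cong refl) (auto simp: b_def tri_zero)
    also have "\<dots> = tri a n m w" using N by (simp add: sum.delta del: atLeastAtMost_iff)
    finally show ?thesis .
  qed
  hence "tri a n m = (\<lambda>w. \<Sum>n'\<in>box N. \<Sum>m'\<in>box N. tri (b n' m') n' m' w)" by auto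
  also have "\<dots> \<in> Bd" by (rule boundary_groupI) (use assms in \<open>auto simp: b_def\<close>)
  finally show ?thesis .
qed

text \<open>The additive cocycle extending \<open>a\<close>; at most one of the two sums can be nonempty.\<close>

definition orbit_sum :: "int \<Rightarrow> ('a \<Rightarrow> int) \<Rightarrow> 'a \<Rightarrow> int" where
  "orbit_sum n a y = (\<Sum>i\<in>{0..<n}. a (P i y)) - (\<Sum>i\<in>{n..<0}. a (P i y))"

lemma orbit_sum_0 [simp]: "orbit_sum 0 a y = 0"
  by (simp add: orbit_sum_def)

lemma orbit_sum_step: "orbit_sum (n + 1) a y = orbit_sum n a y + a (P n y)"
proof (cases "n \<ge> 0")
  case True
  hence "{0..<n + 1} = insert n {0..<n}" "{n + 1..<0} = {}" "{n..<0} = {}" by auto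
  thus ?thesis unfolding orbit_sum_def by simp
next
  case False
  hence "{n..<0} = insert n {n + 1..<0}" "{0..<n + 1} = {}" "{0..<n} = {}" by auto
  thus ?thesis unfolding orbit_sum_def by simp
qed

lemma orbit_sum_add: "orbit_sum n (\<lambda>y. a y + b y) y = orbit_sum n a y + orbit_sum n b y"
  by (simp add: orbit_sum_def sum.distrib)

lemma orbit_sum_zero [simp]: "orbit_sum n (\<lambda>_. 0) y = 0"
  by (simp add: orbit_sum_def)

lemma orbit_sum_continuous:
  assumes "continuous_on UNIV a" shows "continuous_on UNIV (orbit_sum n a)"
proof -
  have "continuous_on UNIV (\<lambda>y. a (P i y))" for i
    by (rule continuous_on_compose2[OF assms P_continuous]) simp
  hence "continuous_on UNIV (\<lambda>y. (\<Sum>i\<in>{0..<n}. a (P i y)) + (\<Sum>i\<in>{n..<0}. - a (P i y)))"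
    by (intro continuous_on_add continuous_on_sum continuous_int_map[where f = uminus])
  thus ?thesis unfolding orbit_sum_def by (simp add: sum_negf)
qed

lemma orbit_sum_cocycle: "orbit_sum (n + m) a y = orbit_sum n a y + orbit_sum m (\<lambda>y. a (P n y)) y"
proof (induction m rule: int_induct[where k = 0])
  case (step1 i)
  thus ?case using orbit_sum_step[of "n + i" a y] orbit_sum_step[of i "\<lambda>y. a (P n y)" y] by (simp add: P_add algebra_simps)
next
  case (step2 i)
  thus ?case using orbit_sum_step[of "n + (i - 1)" a y] orbit_sum_step[of "i - 1" "\<lambda>y. a (P n y)" y] by (simp add: P_add algebra_simps)
qed simp

text \<open>The signed sum over \<open>n + 1\<close> steps from \<open>y\<close> is split in two
  ways, by its first and by its last step.\<close>

lemma orbit_sum_shift: "orbit_sum n a (P 1 y) = orbit_sum n a y + a (P n y) - a y"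
proof -
  have "orbit_sum n a (P 1 y) = orbit_sum n (\<lambda>y. a (P 1 y)) y" by (simp add: orbit_sum_def P_add add.commute del: zpow_1)
  moreover have "orbit_sum (1 + n) a y = orbit_sum 1 a y + orbit_sum n (\<lambda>y. a (P 1 y)) y" by (rule orbit_sum_cocycle)
  moreover have "orbit_sum 1 a y = a y" using orbit_sum_step[of 0 a y] by simp
  ultimately show ?thesis using orbit_sum_step[of n a y] by (simp add: add.commute)
qed

text \<open>The triangle with edges of length \<open>i\<close> and \<open>1\<close> trades the slice
  at \<open>i + 1\<close> for the slice at \<open>i\<close> plus a slice at \<open>1\<close>.
  Iterating in both directions, the slices at \<open>1\<close> add up to \<open>orbit_sum\<close>.
  The slice at \<open>0\<close> is itself a boundary.\<close>

lemma slice_reduce: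
  assumes "continuous_on UNIV a" shows "(\<lambda>w. slice a n w - slice (orbit_sum n a) 1 w) \<in> Bd"
proof (induction n rule: int_induct[where k = 0])
  case base
  have "tri a 0 0 = (\<lambda>w. slice a 0 w - slice (orbit_sum 0 a) 1 w)"
    by (auto simp: tri_def slice_def fun_eq_iff)
  thus ?case using tri_Bd[OF assms, of 0 0] by metis
next
  case (step1 i)
  have "(\<lambda>w. (slice a i w - slice (orbit_sum i a) 1 w) - tri a i 1 w) = (\<lambda>w. slice a (i + 1) w - slice (orbit_sum (i + 1) a) 1 w)"
    by (auto simp: tri_def slice_def fun_eq_iff orbit_sum_step)
  thus ?case using Bd_diff[OF step1(2) tri_Bd[OF assms, of i 1]] by simp
next
  case (step2 i)
  have "(\<lambda>w. (slice a i w - slice (orbit_sum i a) 1 w) + tri a (i - 1) 1 w) = (\<lambda>w. slice a (i - 1) w - slice (orbit_sum (i - 1) a) 1 w)"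
    using orbit_sum_step[of "i - 1" a] by (auto simp: tri_def slice_def fun_eq_iff)
  thus ?case using Bd_add[OF step2(2) tri_Bd[OF assms, of "i - 1" 1]] by simp
qed

text \<open>If \<open>f\<close> is supported in \<open>X \<times> box M\<close>, then \<open>cut M f y\<close> counts, with sign and weight \<open>f\<close>, the arrows within the
  orbit of \<open>y\<close> that cross the cut between \<open>P (- 1) y\<close> and \<open>y\<close>.\<close>

definition cut :: "nat \<Rightarrow> ('a \<times> int \<Rightarrow> int) \<Rightarrow> 'a \<Rightarrow> int" where
  "cut M f y = (\<Sum>k\<in>box M. orbit_sum k (\<lambda>z. f (z, k)) y)"

lemma cut_add: "cut M (\<lambda>w. f w + g w) y = cut M f y + cut M g y"
  by (simp add: cut_def orbit_sum_add sum.distrib)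

lemma cut_zero: "cut M (\<lambda>_. 0) y = 0"
  by (simp add: cut_def)

lemma cut_sum: "finite I \<Longrightarrow> cut M (\<lambda>w. \<Sum>i\<in>I. f i w) y = (\<Sum>i\<in>I. cut M (f i) y)"
  by (induction I rule: finite_induct) (auto simp: cut_zero cut_add)

lemma cut_slice:
  assumes "n \<in> box M" shows "cut M (slice a n) y = orbit_sum n a y"
proof -
  have "cut M (slice a n) y = (\<Sum>k\<in>box M. if k = n then orbit_sum n a y else 0)"
    unfolding cut_def by (intro sum.cong refl) (auto simp: slice_def)
  thus ?thesis using assms by (simp add: sum.delta)
qed

text \<open>By the cocycle identity for \<open>orbit_sum\<close> the three slices cancel. The factor
  2 keeps the index \<open>n + m\<close> inside the box, outside of which \<open>cut M\<close> does
  not see a chain.\<close>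

lemma cut_tri:
  assumes "n \<in> box N" "m \<in> box N" "2 * N \<le> M" shows "cut M (tri a n m) y = 0"
proof -
  have i: "n \<in> box M" "m \<in> box M" "n + m \<in> box M" using assms by auto
  have "(\<lambda>w. tri a n m w + slice a (n + m) w) = (\<lambda>w. slice (\<lambda>y. a (P n y)) m w + slice a n w)"
    by (simp add: tri_def)
  from arg_cong[OF this, of "\<lambda>f. cut M f y"]
  have "cut M (tri a n m) y + cut M (slice a (n + m)) y = cut M (slice (\<lambda>y. a (P n y)) m) y + cut M (slice a n) y"
    unfolding cut_add .
  thus ?thesis using orbit_sum_cocycle[of n m a y] by (simp add: cut_slice i del: atLeastAtMost_iff)
qed

lemma cut_Bd:
  assumes "b \<in> Bd" shows "\<exists>N. \<forall>M\<ge>N. cut M b y = 0"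
proof -
  obtain N a where a: "b = (\<lambda>w. \<Sum>n\<in>box N. \<Sum>m\<in>box N. tri (a n m) n m w)"
    using boundary_groupE[OF assms] by blast
  have "cut M b y = 0" if "M \<ge> 2 * N" for M
    unfolding a by (simp add: cut_sum cut_tri[OF _ _ that])
  thus ?thesis by blast
qed

lemma reduce_to_cut:
  assumes c: "\<And>k. continuous_on UNIV (\<lambda>z. f (z, k))" and supp: "\<And>z k. k \<notin> box M \<Longrightarrow> f (z, k) = 0"
  shows "(\<lambda>w. f w - slice (cut M f) 1 w) \<in> Bd"
proof -
  have "(\<lambda>w. \<Sum>k\<in>box M. slice (\<lambda>z. f (z, k)) k w - slice (orbit_sum k (\<lambda>z. f (z, k))) 1 w) \<in> Bd"
    by (rule Bd_sum) (use slice_reduce[OF c] in auto)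
  moreover have "(\<Sum>k\<in>box M. slice (\<lambda>z. f (z, k)) k w - slice (orbit_sum k (\<lambda>z. f (z, k))) 1 w) = f w - slice (cut M f) 1 w" for w
  proof -
    obtain z l where w: "w = (z, l)" by (cases w)
    have "(\<Sum>k\<in>box M. slice (\<lambda>z. f (z, k)) k w) = f w"
      using supp[of l z] unfolding w slice_def by (auto simp: sum.delta)
    moreover have "(\<Sum>k\<in>box M. slice (orbit_sum k (\<lambda>z. f (z, k))) 1 w) = slice (cut M f) 1 w"
      by (cases "l = 1") (simp_all add: w slice_def cut_def)
    ultimately show ?thesis by (simp add: sum_subtractf)
  qed
  ultimately show ?thesis by simp
qed

section \<open>Index chains of full group elements\<close>

lemma indicator_bis: "\<alpha> \<in> FG \<Longrightarrow> indicator (bis \<alpha>) (y, k) = (if coc \<alpha> (P (- k) y) = k then 1 else 0 :: int)"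
  by (simp add: indicator_def bis_iff)

lemma indicator_bis_continuous:
  assumes "\<alpha> \<in> FG" shows "continuous_on UNIV (\<lambda>z. indicator (bis \<alpha>) (z, k) :: int)"
proof -
  have o: "open {z. P (- k) z \<in> {u. coc \<alpha> u = k}}" "closed {z. P (- k) z \<in> {u. coc \<alpha> u = k}}"
    by (intro open_P closed_P continuous_int_open continuous_int_closed FG_cont_coc assms)+
  have "open ((\<lambda>z. indicator (bis \<alpha>) (z, k) :: int) -` T)" for T
  proof -
    have "(\<lambda>z. indicator (bis \<alpha>) (z, k) :: int) -` T
      = (if 1 \<in> T then {z. P (- k) z \<in> {u. coc \<alpha> u = k}} else {}) \<union>
        (if 0 \<in> T then - {z. P (- k) z \<in> {u. coc \<alpha> u = k}} else {})"
      by (auto simp: indicator_bis[OF assms] split: if_splits)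
    thus ?thesis using o by (auto intro!: open_Un)
  qed
  thus ?thesis by (simp add: continuous_on_open_vimage)
qed

lemma indicator_bis_eq_0:
  assumes "\<alpha> \<in> FG" "\<And>z. \<bar>coc \<alpha> z\<bar> \<le> int M" "k \<notin> box M"
  shows "indicator (bis \<alpha>) (z, k) = (0 :: int)"
  using assms(2)[of "P (- k) z"] assms(3) by (auto simp: indicator_bis[OF assms(1)])

text \<open>Evaluated at \<open>P 1 x\<close>, a summand is an arrow from
  \<open>P (i + 1 - k) x\<close> to \<open>P (i + 1) x\<close>, and \<open>0 \<le> i < k\<close>
  says that it runs from outside \<open>A\<close> into \<open>A\<close>. Since an arrow of a
  bisection is determined by its range, the first sums count the points of \<open>A\<close> not hit
  from \<open>A\<close>, the second ones the points outside \<open>A\<close> that are hit from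
  \<open>A\<close>.\<close>

lemma cut_bis_ind:
  assumes \<alpha>: "\<alpha> \<in> FG" and M: "\<And>z. \<bar>coc \<alpha> z\<bar> \<le> int M"
  shows "cut M (indicator (bis \<alpha>)) (P 1 x) = - ind \<alpha>"
proof -
  note b = FG_bij[OF \<alpha>]
  have mem: "(indicator (bis \<alpha>) (P i (P 1 x), k) :: int) = of_bool (coc \<alpha> (P (i + 1 - k) x) = k)" for i k
    by (simp add: indicator_bis[OF \<alpha>] P_add algebra_simps del: zpow_1)
  have app: "coc \<alpha> (P (i + 1 - k) x) = k \<Longrightarrow> \<alpha> (P (i + 1 - k) x) = P (i + 1) x" for i k
    using FG_coc[OF \<alpha>, of "P (i + 1 - k) x"] by (simp add: P_add)
  have coc_eq: "coc \<alpha> (P j x) = i - j" if "\<alpha> (P j x) = P i x" for i j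
    by (rule cocI) (simp add: that P_add)
  have inj: "inj_on (\<lambda>(k, i). P (i + 1) x) {(k, i). coc \<alpha> (P (i + 1 - k) x) = k}"
  proof (rule inj_onI, clarsimp)
    fix k i l
    assume "coc \<alpha> (P (i + 1 - k) x) = k" "coc \<alpha> (P (i + 1 - l) x) = l"
    hence "\<alpha> (P (i + 1 - k) x) = \<alpha> (P (i + 1 - l) x)" using app by metis
    hence "P (i + 1 - k) x = P (i + 1 - l) x" using b by (simp add: bij_is_inj inj_eq)
    thus "k = l" by simp
  qed
  have count: "(\<Sum>k\<in>box M. \<Sum>i\<in>I k. of_bool (coc \<alpha> (P (i + 1 - k) x) = k)) = int (card Q)"
    if fin: "\<And>k. finite (I k)" and im: "(\<lambda>(k, i). P (i + 1) x) ` {(k, i). k \<in> box M \<and> i \<in> I k \<and> coc \<alpha> (P (i + 1 - k) x) = k} = Q"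
    for I Q
  proof -
    let ?R = "{(k, i). k \<in> box M \<and> i \<in> I k \<and> coc \<alpha> (P (i + 1 - k) x) = k}"
    have "(\<Sum>k\<in>box M. \<Sum>i\<in>I k. of_bool (coc \<alpha> (P (i + 1 - k) x) = k))
      = (\<Sum>v\<in>(SIGMA k:box M. I k). of_bool (coc \<alpha> (P (snd v + 1 - fst v) x) = fst v) :: int)"
      using fin by (subst sum.Sigma) (auto simp: case_prod_unfold)
    also have "\<dots> = int (card ((SIGMA k:box M. I k) \<inter> {v. coc \<alpha> (P (snd v + 1 - fst v) x) = fst v}))"
      using fin by (subst sum_of_bool_eq) (auto intro!: finite_SigmaI)
    also have "(SIGMA k:box M. I k) \<inter> {v. coc \<alpha> (P (snd v + 1 - fst v) x) = fst v} = ?R" by auto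
    also have "card ?R = card ((\<lambda>(k, i). P (i + 1) x) ` ?R)"
      by (rule card_image[symmetric], rule inj_on_subset[OF inj]) auto
    finally show ?thesis unfolding im .
  qed
  have im1: "(\<lambda>(k, i). P (i + 1) x) ` {(k, i). k \<in> box M \<and> i \<in> {0..<k} \<and> coc \<alpha> (P (i + 1 - k) x) = k} = A - \<alpha> ` A"
  proof (intro subset_antisym subsetI)
    fix z assume "z \<in> (\<lambda>(k, i). P (i + 1) x) ` {(k, i). k \<in> box M \<and> i \<in> {0..<k} \<and> coc \<alpha> (P (i + 1 - k) x) = k}"
    then obtain k i where ki: "z = P (i + 1) x" "0 \<le> i" "i < k" "coc \<alpha> (P (i + 1 - k) x) = k" by auto
    have "\<alpha> (P (i + 1 - k) x) = z" "P (i + 1 - k) x \<notin> A" using app[OF ki(4)] ki by auto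
    hence "z \<notin> \<alpha> ` A" using b by (metis bij_is_inj inj_image_mem_iff)
    thus "z \<in> A - \<alpha> ` A" using ki by auto
  next
    fix z assume z: "z \<in> A - \<alpha> ` A"
    then obtain j where j: "j \<ge> 1" "z = P j x" using A_obtain by blast
    have "surj \<alpha>" using b by (rule bij_is_surj)
    then obtain w where w: "\<alpha> w = z" by (metis surjD)
    have "w \<in> orbit" using w z A_subset_orbit FG_orbit[OF \<alpha>] by blast
    then obtain i where i: "w = P i x" unfolding orbit_def by auto
    have "w \<notin> A" using w z by blast
    hence "i \<le> 0" by (simp add: i)
    moreover have cw: "coc \<alpha> (P i x) = j - i" by (rule coc_eq) (use w i j in simp)
    moreover have "j - i \<in> box M" using M[of "P i x"] unfolding cw by auto
    \<comment> \<open>The range of an indexed arrow is \<open>P (i + 1) x\<close>, so the range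
      \<open>P j x\<close> has second index \<open>j - 1\<close>; its step length is
      \<open>j - i\<close>.\<close>
    ultimately show "z \<in> (\<lambda>(k, i). P (i + 1) x) ` {(k, i). k \<in> box M \<and> i \<in> {0..<k} \<and> coc \<alpha> (P (i + 1 - k) x) = k}"
      using j by (intro image_eqI[of _ _ "(j - i, j - 1)"]) auto
  qed
  have im2: "(\<lambda>(k, i). P (i + 1) x) ` {(k, i). k \<in> box M \<and> i \<in> {k..<0} \<and> coc \<alpha> (P (i + 1 - k) x) = k} = \<alpha> ` A - A"
  proof (intro subset_antisym subsetI)
    fix z assume "z \<in> (\<lambda>(k, i). P (i + 1) x) ` {(k, i). k \<in> box M \<and> i \<in> {k..<0} \<and> coc \<alpha> (P (i + 1 - k) x) = k}"
    then obtain k i where ki: "z = P (i + 1) x" "k \<le> i" "i < 0" "coc \<alpha> (P (i + 1 - k) x) = k" by auto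
    have "\<alpha> (P (i + 1 - k) x) = z" "P (i + 1 - k) x \<in> A" using app[OF ki(4)] ki by auto
    hence "z \<in> \<alpha> ` A" by (metis imageI)
    thus "z \<in> \<alpha> ` A - A" using ki by auto
  next
    fix z assume z: "z \<in> \<alpha> ` A - A"
    then obtain i where i: "i \<ge> 1" "z = \<alpha> (P i x)" using A_obtain by blast
    have "P i x \<in> orbit" unfolding orbit_def by (rule rangeI)
    hence "z \<in> orbit" unfolding i(2) FG_orbit[OF \<alpha>] .
    then obtain j where j: "z = P j x" unfolding orbit_def by auto
    have "j \<le> 0" using z j by auto
    moreover have cw: "coc \<alpha> (P i x) = j - i" by (rule coc_eq) (use i j in simp)
    moreover have "j - i \<in> box M" using M[of "P i x"] unfolding cw by auto
    ultimately show "z \<in> (\<lambda>(k, i). P (i + 1) x) ` {(k, i). k \<in> box M \<and> i \<in> {k..<0} \<and> coc \<alpha> (P (i + 1 - k) x) = k}"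
      using i j by (intro image_eqI[of _ _ "(j - i, j - 1)"]) auto
  qed
  have "cut M (indicator (bis \<alpha>)) (P 1 x) =
    (\<Sum>k\<in>box M. \<Sum>i\<in>{0..<k}. of_bool (coc \<alpha> (P (i + 1 - k) x) = k)) -
    (\<Sum>k\<in>box M. \<Sum>i\<in>{k..<0}. of_bool (coc \<alpha> (P (i + 1 - k) x) = k))"
    unfolding cut_def orbit_sum_def mem by (simp only: sum_subtractf)
  also have "\<dots> = int (card (A - \<alpha> ` A)) - int (card (\<alpha> ` A - A))"
    using count[OF _ im1] count[OF _ im2] by simp
  finally show ?thesis by (simp add: ind_def excess_def)
qed

text \<open>Every orbit meets the open level set of \<open>t\<close> through \<open>z\<close>, and
  \<open>t\<close> does not change along an orbit.\<close>

lemma invariant_constant: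
  assumes c: "continuous_on UNIV (t :: 'a \<Rightarrow> int)" and inv: "\<And>y. t (P 1 y) = t y"
  shows "t y = t z"
proof (rule ccontr)
  assume "t y \<noteq> t z"
  hence "{w. t w = t z} \<noteq> {}" by blast
  moreover have "open {w. t w = t z}" by (rule continuous_int_open[OF c])
  ultimately obtain n where "t (P n y) = t z" using orbit_meets by blast
  moreover have "t (P n y) = t y"
  proof (induction n rule: int_induct[where k = 0])
    case (step1 i) thus ?case using inv[of "P i y"] by (simp add: P_add add.commute del: zpow_1)
  next
    case (step2 i) thus ?case using inv[of "P (i - 1) y"] by (simp add: P_add del: zpow_1)
  qed simp
  ultimately show False using \<open>t y \<noteq> t z\<close> by simp
qed

text \<open>By \<open>orbit_sum_shift\<close> the two cuts differ by the number of arrows with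
  source \<open>y\<close> minus the number with range \<open>y\<close>, and a full bisection has
  exactly one of each.\<close>

lemma cut_bis_invariant:
  assumes \<alpha>: "\<alpha> \<in> FG" and M: "\<And>z. \<bar>coc \<alpha> z\<bar> \<le> int M"
  shows "cut M (indicator (bis \<alpha>)) (P 1 y) = cut M (indicator (bis \<alpha>)) y"
proof -
  have "(\<Sum>k\<in>box M. indicator (bis \<alpha>) (P k y, k)) = (\<Sum>k\<in>box M. if coc \<alpha> y = k then 1 else 0 :: int)"
    by (intro sum.cong refl) (simp add: indicator_bis[OF \<alpha>] P_add)
  also have "\<dots> = 1" using M[of y] by (simp add: sum.delta abs_le_iff)
  finally have 1: "(\<Sum>k\<in>box M. indicator (bis \<alpha>) (P k y, k)) = (1 :: int)" .
  have "surj \<alpha>" using FG_bij[OF \<alpha>] by (rule bij_is_surj)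
  then obtain w where w: "y = \<alpha> w" by (metis surjD)
  have "coc \<alpha> (P (- k) y) = k \<longleftrightarrow> coc \<alpha> w = k" for k
  proof
    assume k: "coc \<alpha> (P (- k) y) = k"
    hence "\<alpha> (P (- k) y) = y" using FG_coc[OF \<alpha>, of "P (- k) y"] by (simp add: P_add)
    hence "P (- k) y = w" using w FG_bij[OF \<alpha>] by (metis bij_is_inj injD)
    thus "coc \<alpha> w = k" using k by simp
  next
    assume k: "coc \<alpha> w = k"
    have "P (- k) y = w" using FG_coc[OF \<alpha>, of w] k w by (metis P_eq_iff)
    thus "coc \<alpha> (P (- k) y) = k" using k by simp
  qed
  hence "(\<Sum>k\<in>box M. indicator (bis \<alpha>) (y, k)) = (\<Sum>k\<in>box M. if coc \<alpha> w = k then 1 else 0 :: int)"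
    by (simp add: indicator_bis[OF \<alpha>])
  also have "\<dots> = 1" using M[of w] by (simp add: sum.delta abs_le_iff)
  finally have 2: "(\<Sum>k\<in>box M. indicator (bis \<alpha>) (y, k)) = (1 :: int)" .
  show ?thesis unfolding cut_def orbit_sum_shift sum.distrib sum_subtractf using 1 2 by simp
qed

lemma indicator_bis_Bd:
  assumes \<alpha>: "\<alpha> \<in> FG" shows "indicator (bis \<alpha>) \<in> Bd \<longleftrightarrow> ind \<alpha> = 0"
proof
  assume "indicator (bis \<alpha>) \<in> Bd"
  then obtain N where N: "\<And>M. M \<ge> N \<Longrightarrow> cut M (indicator (bis \<alpha>)) (P 1 x) = 0" using cut_Bd by blast
  obtain L where L: "\<And>z. \<bar>coc \<alpha> z\<bar> \<le> int L" using FG_bounded[OF \<alpha>] by blast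
  \<comment> \<open>One box must contain the whole bisection and also be large enough for
    \<open>cut\<close> to vanish on the boundary.\<close>
  have "\<bar>coc \<alpha> z\<bar> \<le> int (max L N)" for z using L[of z] by linarith
  from cut_bis_ind[OF \<alpha> this] show "ind \<alpha> = 0" using N[of "max L N"] by simp
next
  assume i: "ind \<alpha> = 0"
  obtain L where L: "\<And>z. \<bar>coc \<alpha> z\<bar> \<le> int L" using FG_bounded[OF \<alpha>] by blast
  let ?f = "indicator (bis \<alpha>) :: 'a \<times> int \<Rightarrow> int"
  have "continuous_on UNIV (cut L ?f)"
    unfolding cut_def by (intro continuous_on_sum orbit_sum_continuous indicator_bis_continuous \<alpha>)
  hence "cut L ?f y = cut L ?f (P 1 x)" for y
    by (rule invariant_constant) (rule cut_bis_invariant[OF \<alpha> L])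
  hence "cut L ?f = (\<lambda>_. 0)" using cut_bis_ind[OF \<alpha> L] i by auto
  hence "slice (cut L ?f) 1 w = 0" for w by (auto simp: slice_def split: prod.splits)
  thus "?f \<in> Bd"
    using reduce_to_cut[of ?f L, OF indicator_bis_continuous[OF \<alpha>] indicator_bis_eq_0[OF \<alpha> L]] by simp
qed

lemma index_kernel_eq: "index_kernel G = {\<alpha> \<in> FG. ind \<alpha> = 0}"
proof -
  have coset: "Bd #>\<^bsub>cycle_group G\<^esub> c = {\<lambda>z. h z + c z | h. h \<in> Bd}" for c
    by (auto simp: r_coset_def cycle_group_def)
  have c1: "Bd #>\<^bsub>cycle_group G\<^esub> c = Bd \<longleftrightarrow> c \<in> Bd" for c
  proof
    assume "Bd #>\<^bsub>cycle_group G\<^esub> c = Bd"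
    moreover have "c \<in> Bd #>\<^bsub>cycle_group G\<^esub> c" unfolding coset
      by (rule CollectI, rule exI[of _ "\<lambda>_. 0"]) (simp add: Bd_zero)
    ultimately show "c \<in> Bd" by (simp only:)
  next
    assume c: "c \<in> Bd"
    show "Bd #>\<^bsub>cycle_group G\<^esub> c = Bd"
    proof (intro subset_antisym subsetI)
      fix b assume "b \<in> Bd #>\<^bsub>cycle_group G\<^esub> c"
      thus "b \<in> Bd" unfolding coset using Bd_add[OF _ c] by auto
    next
      fix b assume "b \<in> Bd"
      hence "(\<lambda>w. b w - c w) \<in> Bd" using Bd_diff c by blast
      thus "b \<in> Bd #>\<^bsub>cycle_group G\<^esub> c" unfolding coset
        by (intro CollectI exI[of _ "\<lambda>w. b w - c w"]) simp
    qed
  qed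
  have c2: "\<one>\<^bsub>H1 G\<^esub> = Bd" by (simp add: H1_def FactGroup_def)
  have c3: "index_map G \<alpha> = Bd #>\<^bsub>cycle_group G\<^esub> (indicator (bis \<alpha>))" if "\<alpha> \<in> FG" for \<alpha>
    unfolding index_map_def homology_class_def the_bisection[OF that] ..
  have "index_map G \<alpha> = \<one>\<^bsub>H1 G\<^esub> \<longleftrightarrow> ind \<alpha> = 0" if "\<alpha> \<in> FG" for \<alpha>
    by (simp only: c3[OF that] c2 c1 indicator_bis_Bd[OF that])
  thus ?thesis unfolding index_kernel_def kernel_def carrier_full_group_G
    by (intro Collect_cong conj_cong[OF refl])
qed

section \<open>Periodic approximation of the commutator subgroup\<close>

text \<open>A property of all orbit segments, of any length \<open>h\<close>, whose two end points
  are close enough to \<open>x\<close>. The neighbourhood may depend on the property, so finitely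
  many can be combined.\<close>

definition near :: "('a \<Rightarrow> nat \<Rightarrow> bool) \<Rightarrow> bool" where
  "near Q \<longleftrightarrow> (\<exists>W. open W \<and> x \<in> W \<and> (\<forall>y\<in>W. \<forall>h\<ge>1. P (int h) y \<in> W \<longrightarrow> Q y h))"

lemma near_mono: "near Q \<Longrightarrow> (\<And>y h. Q y h \<Longrightarrow> R y h) \<Longrightarrow> near R"
  unfolding near_def by meson

lemma near_conj: "near Q \<Longrightarrow> near R \<Longrightarrow> near (\<lambda>y h. Q y h \<and> R y h)"
  unfolding near_def
proof (elim exE conjE)
  fix W V assume "open W" "x \<in> W" "open V" "x \<in> V"
    and Q: "\<forall>y\<in>W. \<forall>h\<ge>1. P (int h) y \<in> W \<longrightarrow> Q y h"
    and R: "\<forall>y\<in>V. \<forall>h\<ge>1. P (int h) y \<in> V \<longrightarrow> R y h"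
  thus "\<exists>W. open W \<and> x \<in> W \<and> (\<forall>y\<in>W. \<forall>h\<ge>1. P (int h) y \<in> W \<longrightarrow> Q y h \<and> R y h)"
    by (intro exI[of _ "W \<inter> V"]) auto
qed

lemma near_coc_const:
  assumes \<alpha>: "\<alpha> \<in> FG"
  shows "\<exists>W. open W \<and> x \<in> W \<and> (\<forall>y\<in>W. \<forall>i\<in>{- int N..int N}. coc \<alpha> (P i y) = coc \<alpha> (P i x))"
proof -
  define W where "W = (\<Inter>i\<in>{- int N..int N}. {y. P i y \<in> {u. coc \<alpha> u = coc \<alpha> (P i x)}})"
  have "open W" unfolding W_def
    by (intro open_INT ballI open_P continuous_int_open FG_cont_coc \<alpha>) auto
  moreover have "x \<in> W" by (simp add: W_def)
  moreover have "\<forall>y\<in>W. \<forall>i\<in>{- int N..int N}. coc \<alpha> (P i y) = coc \<alpha> (P i x)" by (simp add: W_def)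
  ultimately show ?thesis by blast
qed

text \<open>As \<open>x\<close> is not periodic, it can be separated from each of finitely many of
  its translates.\<close>

lemma near_no_return: "\<exists>W. open W \<and> x \<in> W \<and> (\<forall>y\<in>W. \<forall>h\<in>{1..N::nat}. P (int h) y \<notin> W)"
proof (induction N)
  case 0 show ?case by (intro exI[of _ UNIV]) auto
next
  case (Suc N)
  then obtain W where W: "open W" "x \<in> W" "\<forall>y\<in>W. \<forall>h\<in>{1..N}. P (int h) y \<notin> W" by blast
  have "x \<noteq> P (int (Suc N)) x" using P_free[of "int (Suc N)" x] by (metis of_nat_eq_0_iff nat.distinct(1))
  from hausdorff[OF this]
  obtain U1 U2 where U: "open U1" "open U2" "x \<in> U1" "P (int (Suc N)) x \<in> U2" "U1 \<inter> U2 = {}"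
    by blast
  define V where "V = W \<inter> U1 \<inter> {y. P (int (Suc N)) y \<in> U2}"
  have "open V" unfolding V_def by (intro open_Int W U open_P)
  moreover have "x \<in> V" using W U by (simp add: V_def)
  moreover have "P (int h) y \<notin> V" if "y \<in> V" "h \<in> {1..Suc N}" for y h
  proof (cases "h = Suc N")
    case True thus ?thesis using that U(5) unfolding V_def by blast
  next
    case False thus ?thesis using that W(3) by (simp add: V_def)
  qed
  ultimately show ?case by blast
qed

lemma near_large: "near (\<lambda>y h. h > N)"
proof -
  obtain W where W: "open W" "x \<in> W" "\<forall>y\<in>W. \<forall>h\<in>{1..N}. P (int h) y \<notin> W" using near_no_return by blast
  have "h > N" if "y \<in> W" "h \<ge> 1" "P (int h) y \<in> W" for y h using W(3) that by (meson atLeastAtMost_iff not_le)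
  thus ?thesis using W unfolding near_def by blast
qed

lemma near_coc: 
  assumes "\<alpha> \<in> FG"
  shows "near (\<lambda>y h. \<forall>i\<in>{- int N..int N}. coc \<alpha> (P i y) = coc \<alpha> (P i x) \<and> coc \<alpha> (P i (P (int h) y)) = coc \<alpha> (P i x))"
  using near_coc_const[OF assms, of N] unfolding near_def by blast

text \<open>Residues modulo \<open>h\<close> are taken in \<open>1..h\<close>, not
  \<open>0..h - 1\<close>: the cut lies between \<open>x\<close> and \<open>P 1 x\<close>, so the
  segment attached to a \<open>y\<close> close to \<open>x\<close> starts at
  \<open>P 1 y\<close>.\<close>

definition wrap :: "nat \<Rightarrow> int \<Rightarrow> int" where
  "wrap h t = (t - 1) mod int h + 1"

lemma wrap_range: "h \<ge> 1 \<Longrightarrow> wrap h t \<in> {1..int h}"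
proof -
  assume "h \<ge> 1"
  hence "(t - 1) mod int h < int h" "0 \<le> (t - 1) mod int h" by simp_all
  thus ?thesis unfolding wrap_def atLeastAtMost_iff by linarith
qed

lemma wrap_id: "t \<in> {1..int h} \<Longrightarrow> wrap h t = t"
  unfolding wrap_def by (simp add: mod_pos_pos_trivial)

lemma wrap_add: "wrap h (t + int h) = wrap h t"
proof -
  have "t + int h - 1 = (t - 1) + int h" by simp
  thus ?thesis unfolding wrap_def by (simp only: mod_add_self2)
qed

text \<open>For \<open>y\<close> and \<open>P h y\<close> close to \<open>x\<close>, the orbit segment from \<open>P 1 y\<close> to \<open>P h y\<close> may be closed up
  to a cycle of length \<open>h\<close>, on which \<open>\<alpha>\<close> induces the following permutation.\<close>

definition per :: "('a \<Rightarrow> 'a) \<Rightarrow> 'a \<Rightarrow> nat \<Rightarrow> nat \<Rightarrow> nat" where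
  "per \<alpha> y h j = (if j \<in> {1..h} then nat (wrap h (int j + coc \<alpha> (P (int j) y))) else j)"

lemma per_in: "j \<in> {1..h} \<Longrightarrow> per \<alpha> y h j = nat (wrap h (int j + coc \<alpha> (P (int j) y)))"
  and per_out: "j \<notin> {1..h} \<Longrightarrow> per \<alpha> y h j = j"
  unfolding per_def by presburger+

lemma per_id: "per id y h = id"
proof
  fix j show "per id y h j = id j" by (auto simp: per_def wrap_id)
qed

text \<open>Wrapping replaces a position \<open>t\<close> outside \<open>1..h\<close> by
  \<open>t + h\<close> or \<open>t - h\<close>. If \<open>N\<close> bounds the cocycle of
  \<open>\<beta>\<close>, such a \<open>t\<close> is within \<open>N\<close> steps of an end of the
  segment, and there \<open>coc \<alpha>\<close> takes the same values around \<open>y\<close> and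
  around \<open>P (int h) y\<close>, namely those around \<open>x\<close>.\<close>

lemma per_comp:
  assumes \<alpha>: "\<alpha> \<in> FG" and \<beta>: "\<beta> \<in> FG"
  shows "near (\<lambda>y h. per (\<alpha> \<circ> \<beta>) y h = per \<alpha> y h \<circ> per \<beta> y h)"
proof -
  obtain N where N: "\<And>z. \<bar>coc \<beta> z\<bar> \<le> int N" using FG_bounded[OF \<beta>] by blast
  show ?thesis
  proof (rule near_mono[OF near_conj[OF near_coc[OF \<alpha>, of N] near_large[of N]]], rule ext)
    fix y h j
    assume a: "(\<forall>i\<in>{- int N..int N}. coc \<alpha> (P i y) = coc \<alpha> (P i x) \<and> coc \<alpha> (P i (P (int h) y)) = coc \<alpha> (P i x)) \<and> N < h"
    show "per (\<alpha> \<circ> \<beta>) y h j = (per \<alpha> y h \<circ> per \<beta> y h) j"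
    proof (cases "j \<in> {1..h}")
      case False show ?thesis unfolding comp_apply per_out[OF False] ..
    next
      case j: True
      hence h1: "h \<ge> 1" by auto
      define t where "t = int j + coc \<beta> (P (int j) y)"
      have bt: "\<beta> (P (int j) y) = P t y"
        using FG_coc[OF \<beta>, of "P (int j) y"] by (simp add: t_def P_add add.commute)
      have tr: "1 - int N \<le> t" "t \<le> int h + int N" using N[of "P (int j) y"] j unfolding t_def by auto
      define j' where "j' = wrap h t"
      have j'r: "j' \<in> {1..int h}" unfolding j'_def by (rule wrap_range[OF h1])
      have pj: "per \<beta> y h j = nat j'" unfolding per_in[OF j] t_def[symmetric] j'_def ..
      have key: "wrap h (j' + coc \<alpha> (P j' y)) = wrap h (t + coc \<alpha> (P t y))"
      proof -
        consider "t \<in> {1..int h}" | "t > int h" | "t \<le> 0" by fastforce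
        thus ?thesis
        proof cases
          case 1 thus ?thesis by (simp add: j'_def wrap_id)
        next
          case 2
          have e: "t - int h \<in> {1..int h}" using 2 tr a by auto
          hence "j' = t - int h" unfolding j'_def using wrap_add[of h "t - int h"] by (simp add: wrap_id)
          moreover have "t - int h \<in> {- int N..int N}" using 2 tr by auto
          hence "coc \<alpha> (P (t - int h) y) = coc \<alpha> (P (t - int h) (P (int h) y))" using a by metis
          hence "coc \<alpha> (P (t - int h) y) = coc \<alpha> (P t y)" by (simp add: P_add)
          ultimately show ?thesis using wrap_add[of h "t - int h + coc \<alpha> (P t y)"] by simp
        next
          case 3
          have e: "t + int h \<in> {1..int h}" using 3 tr a by auto
          hence "j' = t + int h" unfolding j'_def using wrap_add[of h t] by (simp add: wrap_id)
          moreover have "t \<in> {- int N..int N}" using 3 tr by auto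
          hence "coc \<alpha> (P t y) = coc \<alpha> (P t (P (int h) y))" using a by metis
          hence "coc \<alpha> (P (t + int h) y) = coc \<alpha> (P t y)" by (simp add: P_add)
          ultimately show ?thesis using wrap_add[of h "t + coc \<alpha> (P t y)"] by (simp add: algebra_simps)
        qed
      qed
      have "per \<alpha> y h (nat j') = nat (wrap h (j' + coc \<alpha> (P j' y)))"
        using j'r by (subst per_in) auto
      moreover have "per (\<alpha> \<circ> \<beta>) y h j = nat (wrap h (t + coc \<alpha> (P t y)))"
      proof -
        have "int j + coc (\<alpha> \<circ> \<beta>) (P (int j) y) = t + coc \<alpha> (P t y)"
          unfolding coc_comp[OF \<alpha> \<beta>] bt t_def by simp
        thus ?thesis unfolding per_in[OF j] by simp
      qed
      ultimately show ?thesis unfolding comp_apply pj using key by simp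
    qed
  qed
qed

lemma per_inverse:
  assumes \<alpha>: "\<alpha> \<in> FG"
  shows "near (\<lambda>y h. per (inv_into UNIV \<alpha>) y h \<circ> per \<alpha> y h = id)"
proof (rule near_mono[OF per_comp[OF inv_FG[OF \<alpha>] \<alpha>]])
  fix y h assume a: "per (inv_into UNIV \<alpha> \<circ> \<alpha>) y h = per (inv_into UNIV \<alpha>) y h \<circ> per \<alpha> y h"
  have "inv_into UNIV \<alpha> \<circ> \<alpha> = id" using FG_bij[OF \<alpha>] by (simp add: bij_is_inj)
  thus "per (inv_into UNIV \<alpha>) y h \<circ> per \<alpha> y h = id" using a per_id by metis
qed

lemma per_permutes:
  assumes \<alpha>: "\<alpha> \<in> FG"
  shows "near (\<lambda>y h. per \<alpha> y h permutes {1..h})"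
proof (rule near_mono[OF per_inverse[OF \<alpha>]])
  fix y h assume "per (inv_into UNIV \<alpha>) y h \<circ> per \<alpha> y h = id"
  hence "inj (per \<alpha> y h)" by (metis inj_on_id inj_on_imageI2)
  hence inj: "inj_on (per \<alpha> y h) {1..h}" by (rule inj_on_subset) simp
  moreover have sub: "per \<alpha> y h ` {1..h} \<subseteq> {1..h}"
  proof
    fix i assume "i \<in> per \<alpha> y h ` {1..h}"
    then obtain j where j: "j \<in> {1..h}" "i = per \<alpha> y h j" by auto
    hence "wrap h (int j + coc \<alpha> (P (int j) y)) \<in> {1..int h}" by (intro wrap_range) auto
    thus "i \<in> {1..h}" using j by (auto simp: per_def)
  qed
  ultimately have "per \<alpha> y h ` {1..h} = {1..h}" using endo_inj_surj[of "{1..h}"] by blast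
  hence "bij_betw (per \<alpha> y h) {1..h} {1..h}" using inj by (simp add: bij_betw_def)
  thus "per \<alpha> y h permutes {1..h}" by (rule bij_imp_permutes) (auto simp: per_def)
qed

section \<open>Signs of the closed-up permutations\<close>

definition sg :: "('a \<Rightarrow> 'a) \<Rightarrow> 'a \<Rightarrow> nat \<Rightarrow> int" where
  "sg \<alpha> y h = sign (per \<alpha> y h)"

lemma sg_id: "sg id y h = 1"
  by (simp add: sg_def per_id)

lemma sg_comp:
  assumes "\<alpha> \<in> FG" "\<beta> \<in> FG"
  shows "near (\<lambda>y h. sg (\<alpha> \<circ> \<beta>) y h = sg \<alpha> y h * sg \<beta> y h)"
proof (rule near_mono[OF near_conj[OF per_comp[OF assms] near_conj[OF per_permutes[OF assms(1)] per_permutes[OF assms(2)]]]])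
  fix y h
  assume a: "per (\<alpha> \<circ> \<beta>) y h = per \<alpha> y h \<circ> per \<beta> y h \<and> per \<alpha> y h permutes {1..h} \<and> per \<beta> y h permutes {1..h}"
  hence "permutation (per \<alpha> y h)" "permutation (per \<beta> y h)" using permutation_permutes by blast+
  thus "sg (\<alpha> \<circ> \<beta>) y h = sg \<alpha> y h * sg \<beta> y h" unfolding sg_def using a by (simp add: sign_compose)
qed

lemma sg_inv:
  assumes \<alpha>: "\<alpha> \<in> FG"
  shows "near (\<lambda>y h. sg (inv_into UNIV \<alpha>) y h * sg \<alpha> y h = 1)"
proof (rule near_mono[OF sg_comp[OF inv_FG[OF \<alpha>] \<alpha>]])
  fix y h assume a: "sg (inv_into UNIV \<alpha> \<circ> \<alpha>) y h = sg (inv_into UNIV \<alpha>) y h * sg \<alpha> y h"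
  have "inv_into UNIV \<alpha> \<circ> \<alpha> = id" using FG_bij[OF \<alpha>] by (simp add: bij_is_inj)
  thus "sg (inv_into UNIV \<alpha>) y h * sg \<alpha> y h = 1" using a sg_id by metis
qed

text \<open>The values of \<open>sg\<close> commute, so in a commutator those of the factors cancel
  against those of their inverses.\<close>

lemma DG_even:
  assumes "\<alpha> \<in> DG" shows "near (\<lambda>y h. sg \<alpha> y h = 1)"
  using assms
proof (rule DG_induct)
  fix \<alpha> \<beta> assume a: "\<alpha> \<in> FG" "\<beta> \<in> FG"
  let ?a = "inv_into UNIV \<alpha>" and ?b = "inv_into UNIV \<beta>"
  have i: "?a \<in> FG" "?b \<in> FG" "\<alpha> \<circ> \<beta> \<in> FG" "\<alpha> \<circ> \<beta> \<circ> ?a \<in> FG" using a comp_FG inv_FG by auto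
  show "near (\<lambda>y h. sg (\<alpha> \<circ> \<beta> \<circ> ?a \<circ> ?b) y h = 1)"
  proof (rule near_mono[OF near_conj[OF sg_comp[OF i(4,2)] near_conj[OF sg_comp[OF i(3,1)]
      near_conj[OF sg_comp[OF a] near_conj[OF sg_inv[OF a(1)] sg_inv[OF a(2)]]]]]], elim conjE)
    fix y h
    assume "sg (\<alpha> \<circ> \<beta> \<circ> ?a \<circ> ?b) y h = sg (\<alpha> \<circ> \<beta> \<circ> ?a) y h * sg ?b y h"
      "sg (\<alpha> \<circ> \<beta> \<circ> ?a) y h = sg (\<alpha> \<circ> \<beta>) y h * sg ?a y h"
      "sg (\<alpha> \<circ> \<beta>) y h = sg \<alpha> y h * sg \<beta> y h"
      "sg ?a y h * sg \<alpha> y h = 1" "sg ?b y h * sg \<beta> y h = 1"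
    moreover have "a * b * a' * b' = (a' * a) * (b' * b)" for a b a' b' :: int by simp
    ultimately show "sg (\<alpha> \<circ> \<beta> \<circ> ?a \<circ> ?b) y h = 1" by simp
  qed
next
  show "near (\<lambda>y h. sg id y h = 1)" unfolding near_def sg_id by auto
next
  fix \<alpha> \<beta> assume "\<alpha> \<in> FG" "\<beta> \<in> FG" "near (\<lambda>y h. sg \<alpha> y h = 1)" "near (\<lambda>y h. sg \<beta> y h = 1)"
  hence "near (\<lambda>y h. (sg \<alpha> y h = 1 \<and> sg \<beta> y h = 1) \<and> sg (\<alpha> \<circ> \<beta>) y h = sg \<alpha> y h * sg \<beta> y h)"
    by (intro near_conj sg_comp)
  thus "near (\<lambda>y h. sg (\<alpha> \<circ> \<beta>) y h = 1)" by (rule near_mono) auto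
next
  fix \<alpha> assume "\<alpha> \<in> FG" "near (\<lambda>y h. sg \<alpha> y h = 1)"
  hence "near (\<lambda>y h. sg \<alpha> y h = 1 \<and> sg (inv_into UNIV \<alpha>) y h * sg \<alpha> y h = 1)"
    by (intro near_conj sg_inv)
  thus "near (\<lambda>y h. sg (inv_into UNIV \<alpha>) y h = 1)" by (rule near_mono) auto
qed

section \<open>Tower permutations\<close>

lemma continuous_P_comp: "continuous_on UNIV (c :: 'a \<Rightarrow> int) \<Longrightarrow> continuous_on UNIV (\<lambda>y. c (P i y))"
  by (rule continuous_on_compose2[OF _ P_continuous]) auto

text \<open>A coincidence of two different levels would carry a point of \<open>V\<close> back into
  \<open>V\<close> in fewer than \<open>h\<close> steps.\<close>

lemma return_eq:
  assumes ret: "\<forall>y\<in>V. \<forall>i\<in>{1..<h}. P (int i) y \<notin> V"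
    and V: "y \<in> V" "y' \<in> V" and ij: "i \<in> {1..h}" "j \<in> {1..h}" and eq: "P (int i) y = P (int j) y'"
  shows "i = j \<and> y = y'"
proof -
  have e: "P (int j - int i) y' = y" "P (int i - int j) y = y'"
    using eq P_eq_iff[of "int i" y "P (int j) y'"] P_eq_iff[of "int j" y' "P (int i) y"] by (auto simp: P_add)
  have "\<not> i < j"
  proof
    assume "i < j"
    hence "j - i \<in> {1..<h}" "int j - int i = int (j - i)" using ij by auto
    thus False using e(1) ret V by metis
  qed
  moreover have "\<not> j < i"
  proof
    assume "j < i"
    hence "i - j \<in> {1..<h}" "int i - int j = int (i - j)" using ij by auto
    thus False using e(2) ret V by metis
  qed
  ultimately have "i = j" by simp
  thus ?thesis using eq by simp
qed

text \<open>If \<open>V\<close> does not return to itself before time \<open>h\<close>, only the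
  term for the level of \<open>z\<close> can be nonzero. Written as a sum, the cocycle is visibly
  continuous for clopen \<open>V\<close>.\<close>

definition lift :: "'a set \<Rightarrow> nat \<Rightarrow> (nat \<Rightarrow> nat) \<Rightarrow> 'a \<Rightarrow> 'a" where
  "lift V h \<tau> z = P (\<Sum>j\<in>{1..h}. if P (- int j) z \<in> V then int (\<tau> j) - int j else 0) z"

definition tower :: "'a set \<Rightarrow> nat \<Rightarrow> 'a set" where
  "tower V h = {P (int j) y | j y. j \<in> {1..h} \<and> y \<in> V}"

lemma lift_out: "z \<notin> tower V h \<Longrightarrow> lift V h \<tau> z = z"
proof -
  assume z: "z \<notin> tower V h"
  have "P (- int j) z \<notin> V" if "j \<in> {1..h}" for j
  proof
    assume "P (- int j) z \<in> V"
    moreover have "z = P (int j) (P (- int j) z)" by (simp add: P_add)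
    ultimately show False using z that unfolding tower_def by blast
  qed
  hence "(\<Sum>j\<in>{1..h}. if P (- int j) z \<in> V then int (\<tau> j) - int j else 0) = 0"
    by (intro sum.neutral) auto
  thus ?thesis unfolding lift_def by simp
qed

lemma lift_in:
  assumes ret: "\<forall>y\<in>V. \<forall>i\<in>{1..<h}. P (int i) y \<notin> V" and y: "y \<in> V" and j: "j \<in> {1..h}"
  shows "lift V h \<tau> (P (int j) y) = P (int (\<tau> j)) y"
proof -
  have "P (- int i) (P (int j) y) \<in> V \<longleftrightarrow> i = j" if i: "i \<in> {1..h}" for i
  proof
    assume a: "P (- int i) (P (int j) y) \<in> V"
    have "P (int i) (P (- int i) (P (int j) y)) = P (int j) y" by (simp add: P_add)
    from return_eq[OF ret a y i j this] show "i = j" by blast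
  qed (use y in \<open>simp add: P_add\<close>)
  hence "(\<Sum>i\<in>{1..h}. if P (- int i) (P (int j) y) \<in> V then int (\<tau> i) - int i else 0)
    = (\<Sum>i\<in>{1..h}. if i = j then int (\<tau> j) - int j else 0)"
    by (intro sum.cong refl) auto
  also have "\<dots> = int (\<tau> j) - int j" using j by simp
  finally show ?thesis unfolding lift_def by (simp add: P_add)
qed

lemma lift_comp:
  assumes ret: "\<forall>y\<in>V. \<forall>i\<in>{1..<h}. P (int i) y \<notin> V" and \<sigma>: "\<sigma> permutes {1..h}"
  shows "lift V h (\<tau> \<circ> \<sigma>) = lift V h \<tau> \<circ> lift V h \<sigma>"
proof
  fix z
  show "lift V h (\<tau> \<circ> \<sigma>) z = (lift V h \<tau> \<circ> lift V h \<sigma>) z"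
  proof (cases "z \<in> tower V h")
    case True
    then obtain j y where jy: "j \<in> {1..h}" "y \<in> V" "z = P (int j) y" unfolding tower_def by blast
    have "\<sigma> j \<in> {1..h}" using jy(1) \<sigma> by (simp only: permutes_in_image)
    thus ?thesis unfolding jy(3) comp_apply by (simp only: lift_in[OF ret jy(2)] jy(1) comp_apply)
  next
    case False thus ?thesis by (simp add: lift_out)
  qed
qed

lemma lift_id: "lift V h id = id"
proof
  have "(\<Sum>j\<in>{1..h}. if P (- int j) z \<in> V then int (id j) - int j else 0) = 0" for z
    by (intro sum.neutral) simp
  thus "lift V h id z = id z" for z unfolding lift_def by simp
qed

lemma lift_FG:
  assumes ret: "\<forall>y\<in>V. \<forall>i\<in>{1..<h}. P (int i) y \<notin> V" and V: "open V" "closed V"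
    and \<tau>: "\<tau> permutes {1..h}"
  shows "lift V h \<tau> \<in> FG"
proof (rule FGI)
  let ?\<sigma> = "inv_into UNIV \<tau>"
  have \<sigma>: "?\<sigma> permutes {1..h}" "\<tau> \<circ> ?\<sigma> = id" "?\<sigma> \<circ> \<tau> = id"
    using permutes_inv[OF \<tau>] permutes_inv_o[OF \<tau>] by auto
  have "lift V h \<tau> \<circ> lift V h ?\<sigma> = id"
    using lift_comp[OF ret \<sigma>(1), of \<tau>] unfolding \<sigma>(2) lift_id by simp
  moreover have "lift V h ?\<sigma> \<circ> lift V h \<tau> = id"
    using lift_comp[OF ret \<tau>, of ?\<sigma>] unfolding \<sigma>(3) lift_id by simp
  ultimately show "bij (lift V h \<tau>)" using o_bij by blast
  show "lift V h \<tau> z = P (\<Sum>j\<in>{1..h}. if P (- int j) z \<in> V then int (\<tau> j) - int j else 0) z" for z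
    by (rule lift_def)
  have "continuous_on UNIV (\<lambda>z. if z \<in> {z. P (- int j) z \<in> V} then int (\<tau> j) - int j else 0)" for j
    by (intro continuous_int_if open_P closed_P V continuous_on_const)
  thus "continuous_on UNIV (\<lambda>z. \<Sum>j\<in>{1..h}. if P (- int j) z \<in> V then int (\<tau> j) - int j else 0)"
    by (intro continuous_on_sum) simp
qed

text \<open>Since \<open>h \<ge> 5\<close>, the alternating group is perfect, and so is its image under \<open>lift V h\<close>.\<close>

lemma lift_even_DK:
  assumes ret: "\<forall>y\<in>V. \<forall>i\<in>{1..<h}. P (int i) y \<notin> V" and V: "open V" "closed V"
    and side: "\<And>y i j. y \<in> V \<Longrightarrow> i \<in> {1..h} \<Longrightarrow> j \<in> {1..h} \<Longrightarrow> P (int i) y \<in> A \<longleftrightarrow> P (int j) y \<in> A"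
    and \<tau>: "\<tau> permutes {1..h}" "evenperm \<tau>" and h: "h \<ge> 5"
  shows "lift V h \<tau> \<in> DK"
proof -
  have FK: "lift V h \<sigma> \<in> FK" if s: "\<sigma> permutes {1..h}" for \<sigma>
  proof -
    have "lift V h \<sigma> z \<in> A \<longleftrightarrow> z \<in> A" for z
    proof (cases "z \<in> tower V h")
      case True
      then obtain j y where jy: "j \<in> {1..h}" "y \<in> V" "z = P (int j) y" unfolding tower_def by blast
      have sj: "\<sigma> j \<in> {1..h}" using jy(1) s by (simp only: permutes_in_image)
      show ?thesis unfolding jy(3) lift_in[OF ret jy(2,1)] by (rule side[OF jy(2) sj jy(1)])
    qed (simp add: lift_out)
    thus ?thesis using lift_FG[OF ret V s] FK_iff by blast
  qed
  interpret hom: group_hom "alt_group h" "fun_group FK" "lift V h"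
  proof (rule group_hom.intro[OF alt_group_is_group group_FK], unfold_locales, rule homI)
    fix \<sigma> assume "\<sigma> \<in> carrier (alt_group h)"
    thus "lift V h \<sigma> \<in> carrier (fun_group FK)" using FK alt_group_carrier by simp
  next
    fix \<rho> \<sigma> assume "\<rho> \<in> carrier (alt_group h)" "\<sigma> \<in> carrier (alt_group h)"
    thus "lift V h (\<rho> \<otimes>\<^bsub>alt_group h\<^esub> \<sigma>) = lift V h \<rho> \<otimes>\<^bsub>fun_group FK\<^esub> lift V h \<sigma>"
      using lift_comp[OF ret, of \<sigma> \<rho>] alt_group_carrier by (simp add: alt_group_mult)
  qed
  have "\<tau> \<in> derived (alt_group h) (carrier (alt_group h))"
    using derived_alt_group_const[OF h] \<tau> alt_group_carrier by blast
  hence "lift V h \<tau> \<in> derived (fun_group FK) (lift V h ` carrier (alt_group h))"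
    using hom.derived_img[of "carrier (alt_group h)"] by blast
  moreover have "lift V h ` carrier (alt_group h) \<subseteq> FK" using FK alt_group_carrier by blast
  hence "derived (fun_group FK) (lift V h ` carrier (alt_group h)) \<subseteq> DK"
    unfolding DK_eq by (intro group.mono_derived[OF group_FK]) auto
  ultimately show ?thesis by blast
qed

text \<open>First return to a small clopen \<open>B\<close> containing \<open>x\<close> partitions
  the space into towers. Return times are bounded and each length allows finitely many permutations,
  so \<open>\<gamma>\<close> is a finite product of lifts of even permutations.\<close>

lemma DG_inter_FK_subset_DK:
  assumes D: "\<gamma> \<in> DG" and K: "\<gamma> \<in> FK"
  shows "\<gamma> \<in> DK"
proof -
  have \<gamma>: "\<gamma> \<in> FG" using K by (simp add: FK_def)
  obtain N where N: "\<And>z. \<bar>coc \<gamma> z\<bar> \<le> int N" using FG_bounded[OF \<gamma>] by blast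
  \<comment> \<open>The 5 in the bound on \<open>h\<close> feeds \<open>lift_even_DK\<close>.
    Agreement with \<open>x\<close> is required on \<open>N\<close> steps around both ends because
    levels further inside cannot be carried out of the segment.\<close>
  have "near (\<lambda>y h. sg \<gamma> y h = 1 \<and> per \<gamma> y h permutes {1..h} \<and> h > 2 * N + 5 \<and>
     (\<forall>i\<in>{- int N..int N}. coc \<gamma> (P i y) = coc \<gamma> (P i x) \<and> coc \<gamma> (P i (P (int h) y)) = coc \<gamma> (P i x)))"
    by (intro near_conj DG_even[OF D] per_permutes[OF \<gamma>] near_large near_coc[OF \<gamma>])
  then obtain W where W: "open W" "x \<in> W" and near: "\<And>y h. y \<in> W \<Longrightarrow> h \<ge> 1 \<Longrightarrow> P (int h) y \<in> W \<Longrightarrow>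
     sg \<gamma> y h = 1 \<and> per \<gamma> y h permutes {1..h} \<and> h > 2 * N + 5 \<and>
     (\<forall>i\<in>{- int N..int N}. coc \<gamma> (P i y) = coc \<gamma> (P i x) \<and> coc \<gamma> (P i (P (int h) y)) = coc \<gamma> (P i x))"
    unfolding near_def by blast
  obtain B where B: "open B" "closed B" "x \<in> B" "B \<subseteq> W" using clopen_basis[OF W] by blast
  obtain L :: nat where L: "\<And>z. \<exists>i\<in>{1..L}. P (int i) z \<in> B" using recurrence[OF B(1)] B(3) by blast
  define first where "first y h \<longleftrightarrow> y \<in> B \<and> h \<ge> 1 \<and> P (int h) y \<in> B \<and> (\<forall>i\<in>{1..<h}. P (int i) y \<notin> B)" for y h
  have nr: "sg \<gamma> y h = 1 \<and> per \<gamma> y h permutes {1..h} \<and> h > 2 * N + 5 \<and>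
     (\<forall>i\<in>{- int N..int N}. coc \<gamma> (P i y) = coc \<gamma> (P i x) \<and> coc \<gamma> (P i (P (int h) y)) = coc \<gamma> (P i x))"
    if f: "first y h" for y h
  proof (rule near)
    show "y \<in> W" "P (int h) y \<in> W" using f B(4) unfolding first_def by blast+
    show "1 \<le> h" using f unfolding first_def by blast
  qed
  \<comment> \<open>As \<open>\<gamma>\<close> preserves \<open>A\<close>, it does not cross the cut
    on the orbit of \<open>x\<close> (\<open>Ax\<close>). Around both ends of a segment its cocycle
    agrees with that around \<open>x\<close>, so it leaves the segment at neither end, and no
    wrapping occurs.\<close>
  have step: "\<gamma> (P (int j) y) = P (int (per \<gamma> y h j)) y" if f: "first y h" and j: "j \<in> {1..h}" for y h j
  proof -
    note n = nr[OF f]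
    define t where "t = int j + coc \<gamma> (P (int j) y)"
    have gt: "\<gamma> (P (int j) y) = P t y" using FG_coc[OF \<gamma>, of "P (int j) y"] unfolding t_def P_add by (simp add: add.commute)
    have Ax: "i + coc \<gamma> (P i x) \<ge> 1 \<longleftrightarrow> i \<ge> 1" for i
    proof -
      have "\<gamma> (P i x) = P (i + coc \<gamma> (P i x)) x" using FG_coc[OF \<gamma>, of "P i x"] unfolding P_add by (simp add: add.commute)
      hence "i + coc \<gamma> (P i x) \<ge> 1 \<longleftrightarrow> \<gamma> (P i x) \<in> A" by simp
      also have "\<dots> \<longleftrightarrow> P i x \<in> A" using K FK_iff by blast
      finally show ?thesis by simp
    qed
    have "t \<ge> 1"
    proof (cases "j \<le> N")
      case True
      hence "coc \<gamma> (P (int j) y) = coc \<gamma> (P (int j) x)" using n by auto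
      thus ?thesis using Ax[of "int j"] j unfolding t_def by simp
    next
      case False thus ?thesis using N[of "P (int j) y"] unfolding t_def by linarith
    qed
    moreover have "t \<le> int h"
    proof (cases "j + N \<le> h")
      case True thus ?thesis using N[of "P (int j) y"] unfolding t_def by linarith
    next
      case False
      define i where "i = int j - int h"
      have ir: "i \<in> {- int N..int N}" "i \<le> 0" using False j unfolding i_def by auto
      have "coc \<gamma> (P i (P (int h) y)) = coc \<gamma> (P i x)" using n ir(1) by blast
      hence "coc \<gamma> (P (int j) y) = coc \<gamma> (P i x)" by (simp add: P_add i_def)
      thus ?thesis using Ax[of i] ir(2) unfolding t_def i_def by linarith
    qed
    ultimately have t: "t \<in> {1..int h}" by simp
    have "per \<gamma> y h j = nat t" unfolding per_in[OF j] t_def[symmetric] wrap_id[OF t] ..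
    thus ?thesis using gt t by simp
  qed
  \<comment> \<open>The index \<open>v\<close> is a return time together with a permutation.
    Refining by the permutation makes \<open>\<gamma>\<close> act in the same way over all base
    points of a piece, so that a single \<open>lift\<close> describes it.\<close>
  define V where "V v = {y. first y (fst v) \<and> per \<gamma> y (fst v) = snd v}" for v
  have Vf: "first y (fst v)" "per \<gamma> y (fst v) = snd v" if "y \<in> V v" for y v using that by (auto simp: V_def)
  have ret: "\<forall>y\<in>V v. \<forall>i\<in>{1..<fst v}. P (int i) y \<notin> V v" for v
    unfolding V_def first_def by blast
  define I where "I = {v. V v \<noteq> {}}"
  have Iprop: "snd v permutes {1..fst v} \<and> evenperm (snd v) \<and> fst v \<ge> 5" and IL: "fst v \<le> L" if "v \<in> I" for v
  proof -
    from that obtain y where y: "y \<in> V v" by (auto simp: I_def)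
    have "sg \<gamma> y (fst v) = 1" "per \<gamma> y (fst v) permutes {1..fst v}" "fst v > 2 * N + 5" using nr[OF Vf(1)[OF y]] by auto
    thus "snd v permutes {1..fst v} \<and> evenperm (snd v) \<and> fst v \<ge> 5"
      unfolding Vf(2)[OF y] sg_def sign_def by (auto split: if_splits)
    obtain i where i: "i \<in> {1..L}" "P (int i) y \<in> B" using L by blast
    hence "\<not> i < fst v" using Vf(1)[OF y] by (auto simp: first_def)
    thus "fst v \<le> L" using i by auto
  qed
  have "finite I"
  proof (rule finite_subset)
    show "I \<subseteq> (SIGMA h:{..L}. {p. p permutes {1..h}})" using Iprop IL by (auto simp: mem_Times_iff)
    show "finite (SIGMA h:{..L}. {p. p permutes {1..h}})" by (intro finite_SigmaI finite_permutations) auto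
  qed
  have Vclopen: "open (V v) \<and> closed (V v)" if v: "v \<in> I" for v
  proof -
    define h where "h = fst v"
    define C where "C j = {y. nat (wrap h (int j + coc \<gamma> (P (int j) y))) = snd v j}" for j
    have h1: "h \<ge> 1" using Iprop[OF v] by (simp add: h_def)
    have p: "snd v permutes {1..h}" using Iprop[OF v] by (simp add: h_def)
    have "per \<gamma> y h = snd v \<longleftrightarrow> (\<forall>j\<in>{1..h}. y \<in> C j)" for y
    proof
      assume e: "per \<gamma> y h = snd v"
      show "\<forall>j\<in>{1..h}. y \<in> C j" unfolding C_def e[symmetric] using per_in by auto
    next
      assume c: "\<forall>j\<in>{1..h}. y \<in> C j"
      show "per \<gamma> y h = snd v"
      proof
        fix j show "per \<gamma> y h j = snd v j"
        proof (cases "j \<in> {1..h}")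
          case True thus ?thesis using c unfolding C_def per_in[OF True] by blast
        next
          case False thus ?thesis using per_out[OF False] permutes_not_in[OF p False] by simp
        qed
      qed
    qed
    hence eq: "V v = B \<inter> {y. P (int h) y \<in> B} \<inter> (\<Inter>i\<in>{1..<h}. {y. P (int i) y \<in> - B}) \<inter> (\<Inter>j\<in>{1..h}. C j)"
      unfolding V_def first_def h_def[symmetric] using h1 by blast
    have c: "open (C j)" "closed (C j)" for j unfolding C_def
      using continuous_int_open[OF continuous_P_comp[OF FG_cont_coc[OF \<gamma>]], where P = "\<lambda>t. nat (wrap h (int j + t)) = snd v j"]
        continuous_int_closed[OF continuous_P_comp[OF FG_cont_coc[OF \<gamma>]], where P = "\<lambda>t. nat (wrap h (int j + t)) = snd v j"]
      by auto
    have "open (V v)" unfolding eq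
      by (intro open_Int open_INT ballI open_P B(1) open_Compl B(2) c finite_atLeastLessThan finite_atLeastAtMost)
    moreover have "closed (V v)" unfolding eq
      by (intro closed_Int closed_INT ballI closed_P B(1) closed_Compl B(2) c)
    ultimately show ?thesis by blast
  qed
  \<comment> \<open>As \<open>x\<close> lies in \<open>B\<close>, a segment between consecutive
    visits to \<open>B\<close> can meet \<open>x\<close> only at its ends, so its levels
    \<open>1..h\<close> all lie on one side of the cut.\<close>
  have side: "P (int i) y \<in> A \<longleftrightarrow> P (int j) y \<in> A"
    if y: "y \<in> V v" and ij: "i \<in> {1..fst v}" "j \<in> {1..fst v}" for y v i j
  proof (cases "y \<in> orbit")
    case False thus ?thesis using A_subset_orbit by (metis P_in_orbit subsetD)
  next
    case True
    then obtain k where k: "y = P k x" unfolding orbit_def by auto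
    show ?thesis
    proof (cases "k \<ge> 0")
      case True thus ?thesis using ij by (simp add: k P_add)
    next
      case False
      have "\<not> nat (- k) < fst v"
      proof
        assume "nat (- k) < fst v"
        hence "nat (- k) \<in> {1..<fst v}" using False by auto
        hence "P (int (nat (- k))) y \<notin> B" using Vf(1)[OF y] unfolding first_def by blast
        moreover have "P (int (nat (- k))) y = x" using False by (simp add: k P_add)
        ultimately show False using B(3) by simp
      qed
      thus ?thesis using ij False by (auto simp: k P_add)
    qed
  qed
  have liftDK: "lift (V v) (fst v) (snd v) \<in> DK" if "v \<in> I" for v
    by (rule lift_even_DK[OF ret _ _ side]) (use Vclopen[OF that] Iprop[OF that] in auto)
  define tow where "tow v = tower (V v) (fst v)" for v
  have lift_\<gamma>: "lift (V v) (fst v) (snd v) z = \<gamma> z \<and> \<gamma> z \<in> tow v" if v: "v \<in> I" and z: "z \<in> tow v" for v z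
  proof -
    obtain j y where jy: "j \<in> {1..fst v}" "y \<in> V v" "z = P (int j) y" using z unfolding tow_def tower_def by blast
    have g: "\<gamma> z = P (int (snd v j)) y" unfolding jy(3) step[OF Vf(1)[OF jy(2)] jy(1)] Vf(2)[OF jy(2)] ..
    have "snd v permutes {1..fst v}" using Iprop[OF v] by blast
    hence "snd v j \<in> {1..fst v}" using jy(1) by (simp only: permutes_in_image)
    hence "\<gamma> z \<in> tow v" unfolding tow_def tower_def g using jy(2) by blast
    moreover have "lift (V v) (fst v) (snd v) z = P (int (snd v j)) y"
      unfolding jy(3) by (rule lift_in[OF ret jy(2,1)])
    ultimately show ?thesis using g by simp
  qed
  have disj: "u = v" if u: "z \<in> tow u" and v: "z \<in> tow v" for u v z
  proof -
    obtain i y where iy: "i \<in> {1..fst u}" "y \<in> V u" "z = P (int i) y" using u unfolding tow_def tower_def by blast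
    obtain j y' where jy: "j \<in> {1..fst v}" "y' \<in> V v" "z = P (int j) y'" using v unfolding tow_def tower_def by blast
    note fu = Vf(1)[OF iy(2)] and fv = Vf(1)[OF jy(2)]
    have e: "P (int j - int i) y' = y" "P (int i - int j) y = y'"
      using iy(3) jy(3) P_eq_iff[of "int i" y z] P_eq_iff[of "int j" y' z] by (auto simp: P_add)
    have "\<not> i < j"
    proof
      assume "i < j"
      hence "j - i \<in> {1..<fst v}" "int j - int i = int (j - i)" using iy(1) jy(1) by auto
      thus False using fv fu e(1) unfolding first_def by metis
    qed
    moreover have "\<not> j < i"
    proof
      assume "j < i"
      hence "i - j \<in> {1..<fst u}" "int i - int j = int (i - j)" using iy(1) jy(1) by auto
      thus False using fv fu e(2) unfolding first_def by metis
    qed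
    ultimately have yy: "y = y'" using e by simp
    have "\<not> fst u < fst v" "\<not> fst v < fst u" using fu fv unfolding yy first_def by auto
    hence "fst u = fst v" by simp
    moreover from this have "snd u = snd v" using Vf(2)[OF iy(2)] Vf(2)[OF jy(2)] yy by simp
    ultimately show "u = v" by (rule prod_eqI)
  qed
  \<comment> \<open>The base point below \<open>z\<close> is the last visit to \<open>B\<close>
    strictly before \<open>z\<close>, since levels start at 1. Such a visit exists:
    \<open>L + 1\<close> steps back, the next return takes at most \<open>L\<close> steps and so
    happens at least one step before \<open>z\<close>.\<close>
  have cover: "\<exists>v\<in>I. z \<in> tow v" for z
  proof -
    have "\<exists>j\<ge>1. P (- int j) z \<in> B"
    proof -
      obtain i where i: "i \<in> {1..L}" "P (int i) (P (- int (L + 1)) z) \<in> B" using L by blast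
      have e: "int i + - int (L + 1) = - int (L + 1 - i)" using i(1) by auto
      have "P (- int (L + 1 - i)) z \<in> B" using i(2) unfolding P_add e .
      moreover have "L + 1 - i \<ge> 1" using i(1) by auto
      ultimately show ?thesis by blast
    qed
    then obtain j where j: "j \<ge> 1" "P (- int j) z \<in> B" "\<And>i. i < j \<Longrightarrow> \<not> (i \<ge> 1 \<and> P (- int i) z \<in> B)"
      using exists_least_iff[of "\<lambda>j. j \<ge> 1 \<and> P (- int j) z \<in> B"] by blast
    define y where "y = P (- int j) z"
    have "\<exists>h\<ge>1. P (int h) y \<in> B" using L[of y] by auto
    then obtain h where h: "h \<ge> 1" "P (int h) y \<in> B" "\<And>i. i < h \<Longrightarrow> \<not> (i \<ge> 1 \<and> P (int i) y \<in> B)"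
      using exists_least_iff[of "\<lambda>h. h \<ge> 1 \<and> P (int h) y \<in> B"] by blast
    have "y \<in> B" using j(2) unfolding y_def .
    moreover have "\<forall>i\<in>{1..<h}. P (int i) y \<notin> B" using h(3) by simp
    ultimately have f: "first y h" using h(1,2) unfolding first_def by blast
    have "\<not> h < j"
    proof
      assume hj: "h < j"
      hence e: "int h + - int j = - int (j - h)" by simp
      have "P (- int (j - h)) z \<in> B" using h(2) unfolding y_def P_add e .
      thus False using j(3)[of "j - h"] hj h(1) by auto
    qed
    hence jr: "j \<in> {1..h}" using j(1) by auto
    have yV: "y \<in> V (h, per \<gamma> y h)" using f by (simp add: V_def)
    moreover have "z = P (int j) y" by (simp add: y_def P_add)
    ultimately have "z \<in> tow (h, per \<gamma> y h)" using jr unfolding tow_def tower_def fst_conv by blast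
    moreover have "(h, per \<gamma> y h) \<in> I" using yV unfolding I_def by blast
    ultimately show ?thesis by blast
  qed
  \<comment> \<open>Partial products over a set of towers. Towers are disjoint and
    \<open>\<gamma>\<close> preserves each of them, so adding a tower amounts to composing with its
    lift.\<close>
  define part where "part S z = (if \<exists>v\<in>S. z \<in> tow v then \<gamma> z else z)" for S z
  have "part S \<in> DK" if "finite S" "S \<subseteq> I" for S
    using that
  proof (induction S rule: finite_induct)
    case empty
    have "part {} = id" by (auto simp: part_def)
    thus ?case using subgroup.one_closed[OF subgroup_DK] by (simp only: monoid.simps)
  next
    case (insert v S)
    have v: "v \<in> I" and S: "S \<subseteq> I" using insert.prems by auto
    have "part (insert v S) = lift (V v) (fst v) (snd v) \<circ> part S"
    proof
      fix z
      consider "z \<in> tow v" | u where "u \<in> S" "z \<in> tow u" | "z \<notin> tow v" "\<not> (\<exists>u\<in>S. z \<in> tow u)" by blast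
      thus "part (insert v S) z = (lift (V v) (fst v) (snd v) \<circ> part S) z"
      proof cases
        case 1
        hence "\<not> (\<exists>u\<in>S. z \<in> tow u)" using disj insert.hyps(2) by blast
        thus ?thesis using 1 lift_\<gamma>[OF v 1] by (simp add: part_def)
      next
        case 2
        have "\<gamma> z \<in> tow u" using lift_\<gamma>[of u z] 2 S by blast
        hence "\<gamma> z \<notin> tow v" using disj[of "\<gamma> z" u v] 2 insert.hyps(2) by blast
        hence "lift (V v) (fst v) (snd v) (\<gamma> z) = \<gamma> z" unfolding tow_def by (rule lift_out)
        moreover have "part S z = \<gamma> z" "part (insert v S) z = \<gamma> z" using 2 by (auto simp: part_def)
        ultimately show ?thesis by simp
      next
        case 3
        hence "lift (V v) (fst v) (snd v) z = z" unfolding tow_def by (intro lift_out)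
        moreover have "part S z = z" "part (insert v S) z = z" using 3 by (auto simp: part_def)
        ultimately show ?thesis by simp
      qed
    qed
    thus ?case using subgroup.m_closed[OF subgroup_DK liftDK[OF v] insert.IH[OF S]] by (simp only: monoid.simps)
  qed
  moreover have "part I = \<gamma>" using cover by (auto simp: part_def)
  ultimately show ?thesis using \<open>finite I\<close> by blast
qed

section \<open>Maximal subgroups\<close>

lemma maximal_index_kernel:
  "maximal_subgroup (carrier (full_group K)) (full_group G \<lparr>carrier := index_kernel G\<rparr>)"
proof -
  have sub: "subgroup {\<alpha> \<in> FG. ind \<alpha> = 0} (fun_group FG)"
  proof (rule fun_subgroupI[OF group_FG])
    fix f g assume "f \<in> {\<alpha> \<in> FG. ind \<alpha> = 0}" "g \<in> {\<alpha> \<in> FG. ind \<alpha> = 0}"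
    thus "f \<circ> g \<in> {\<alpha> \<in> FG. ind \<alpha> = 0}"
      using ind_comp comp_FG by (metis (mono_tags, lifting) add_0 mem_Collect_eq)
  next
    fix f assume "f \<in> {\<alpha> \<in> FG. ind \<alpha> = 0}"
    thus "inv_into UNIV f \<in> {\<alpha> \<in> FG. ind \<alpha> = 0}" using ind_inv inv_FG by simp
  qed (use FG_bij id_FG ind_id in auto)
  have "DG \<subseteq> {\<alpha> \<in> FG. ind \<alpha> = 0}"
    using DG_ind subgroup.subset[OF subgroup_DG] by auto
  from maximal_in_stabilizer[OF sub this]
  have "maximal_subgroup ({\<alpha> \<in> FG. ind \<alpha> = 0} \<inter> FK) (fun_group {\<alpha> \<in> FG. ind \<alpha> = 0})" by simp
  moreover have "{\<alpha> \<in> FG. ind \<alpha> = 0} \<inter> FK = FK" by (auto simp: FK_def ind_def)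
  ultimately show ?thesis
    unfolding carrier_full_group_K index_kernel_eq unfolding full_group_G by simp
qed

lemma maximal_commutator_group:
  "maximal_subgroup (commutator_group K) (full_group G \<lparr>carrier := commutator_group G\<rparr>)"
proof -
  have "DG \<inter> FK = DK" using DG_inter_FK_subset_DK DK_subset_DG DK_subset_FK by blast
  thus ?thesis using maximal_in_stabilizer[OF subgroup_DG subset_refl DG_ind] by (simp add: full_group_G)
qed

end

theorem theorem6p9:
  fixes \<phi> :: "'a::t2_space \<Rightarrow> 'a" and x :: 'a
  assumes "cantor_set (UNIV :: 'a set)"
    and "self_homeo \<phi>"
    and "minimal \<phi>"
  defines "G \<equiv> transformation_groupoid \<phi>"
    and "K \<equiv> orbit_breaking \<phi> x"
  shows "maximal_subgroup (carrier (full_group K)) (full_group G \<lparr>carrier := index_kernel G\<rparr>)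
       \<and> maximal_subgroup (commutator_group K) (full_group G \<lparr>carrier := commutator_group G\<rparr>)"
proof -
  interpret minimal_cantor \<phi> x by unfold_locales fact+
  show ?thesis unfolding G_def K_def using maximal_index_kernel maximal_commutator_group by blast
qed

end
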